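(* Let $\mathcal N$ be an $L(\mathcal N)$-Lipschitz continuous neural network, i.e. the neural network maps the input data to the output data Lipschitz continuously with Lipschitz constant $L(\mathcal N)$. Let $f,f_i\in C(\bar\Omega)$ be right hand sides with coarse finite element solutions $u_H,u_H^i\in V_H$, and let $w_{\mathcal N}^{\mathcal P}$, $w_{\mathcal N}^{\mathcal P,i}$ be the corresponding network updates on a patch $\mathcal P$. Then $$ \|\nabla(w_{\mathcal N}^{\mathcal P}-w_{\mathcal N}^{\mathcal P,i})\|_{\mathcal P}\le c\,L(\mathcal N)\,h^{-1}\Big(\|u_H-u_H^i\|_{\mathcal P}+\|I_h(f-f_i)\|_{\mathcal P}\Big), $$ where $I_h(f-f_i)\in V_h(\mathcal P)$ denotes the Lagrange interpolant of $f-f_i\in C(\bar\Omega)$ on the patch $\mathcal P$, and $c>0$ is a constant independent of $h,H,h_{\mathcal P},f,f_i$ and $\mathcal N$.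
   Context: **Domain and meshes.** $\Omega\subset\mathbb R^d$, $d\in\{2,3\}$, is a domain with polygonal boundary. There is a hierarchy of quadrilateral or triangular (2D), hexahedral or tetrahedral (3D) meshes $\Omega_{h_{\mathcal P}}\preccurlyeq\dots\preccurlyeq\Omega_H\preccurlyeq\dots\preccurlyeq\Omega_h$, each obtained from the previous one by uniform refinement of every cell, satisfying the usual assumptions of structural and shape regularity; the subscript is the diameter of the largest cell. The meshes $\Omega_H$ and $\Omega_h$ are quasi-uniform. A patch $\mathcal P$ is a subdomain that is the union of certain cells of $\Omega_{h_{\mathcal P}}$, with diameter of order $h_{\mathcal P}$. **Finite elements.** For fixed $r\ge1$, $V_h=\{\phi\in C(\bar\Omega):\phi|_T\in P^{(r)}(T)\ \forall T\in\Omega_h,\ \phi|_{\partial\Omega}=0\}$, where $P^{(r)}(T)$ denotes polynomials of degree at most $r$ on simplices and tensor-product polynomials of degree at most $r$ in each coordinate on quadrilaterals/hexahedra; $V_H\subset V_h$ is defined likewise on $\Omega_H$. $u_H\in V_H$ solves $(\nabla u_H,\nabla\phi_H)=\langle f,\phi_H\rangle$ for all $\phi_H\in V_H$, where $(\cdot,\cdot)$ is the $L^2(\Omega)$ inner product and $\langle\cdot,\cdot\rangle$ the duality pairing between $H^{-1}(\Omega)$ and $H^1_0(\Omega)$; $u_H^i\in V_H$ solves the same problem with right hand side $f_i$. The local space is $V_h(\mathcal P)=\operatorname{span}\{\phi_h|_{\mathcal P}:\phi_h\in V_h\}$, the restrictions to $\mathcal P$ of functions in $V_h$. $\|\cdot\|_{\mathcal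 P}$ is the $L^2(\mathcal P)$-norm. **Nodes and interpolation.** $X^h_{\mathcal P}$, $X^H_{\mathcal P}$ are the sets of nodes of $\Omega_h$, $\Omega_H$ lying in $\overline{\mathcal P}$. The Lagrange interpolant $I_hg\in V_h(\mathcal P)$ of $g\in C(\bar\Omega)$ is the function in $V_h(\mathcal P)$ that takes the values of $g$ at the nodes carrying the degrees of freedom of $V_h(\mathcal P)$. **Network updates.** A neural network is a multilayer perceptron $\mathcal N=l_L\circ\sigma\circ l_{L-1}\circ\dots\circ\sigma\circ l_1:\mathbb R^{N_0}\to\mathbb R^{N_L}$ with affine layers $l_j(x)=W_jx+b_j$ (weight matrices $W_j$, bias vectors $b_j$) and activation function $\sigma:\mathbb R\to\mathbb R$ applied componentwise; Lipschitz continuity is with respect to Euclidean norms. Let $\mathrm x_{\mathcal P}=\big((u_H(x))_{x\in X^H_{\mathcal P}},(f(x))_{x\in X^h_{\mathcal P}}\big)$ and $\mathrm x^i_{\mathcal P}=\big((u^i_H(x))_{x\in X^H_{\mathcal P}},(f_i(x))_{x\in X^h_{\mathcal P}}\big)$, with a consistent ordering of the nodes. With the nodal basis functions $\phi_j^{\mathcal P}$, $j=1,\dots,N_{dof}$, of $V_h(\mathcal P)$, the network updates are $w_{\mathcal N}^{\mathcal P}=\sum_{j=1}^{N_{dof}}\mathcal N(\mathrm x_{\mathcal P})_j\,\phi_j^{\mathcal P}$ and $w_{\mathcal N}^{\mathcal P,i}=\sum_{j=1}^{N_{dof}}\mathcal N(\mathrm x^i_{\mathcal P})_j\,\phi_j^{\mathcal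 P}$, where $\mathcal N(\cdot)_j$ is the $j$-th output of the network.
   Formalization: The node sets of the network input contain only nodes carrying degrees of freedom, so nodes on the boundary of Ω are left out; if f were also sampled at boundary nodes the estimate would fail for patches touching the boundary. *)

theory Defs
  imports "HOL-Analysis.Analysis" "Jordan_Normal_Form.Matrix"
begin

(* Jordan_Normal_Form.Matrix supplies the vectors and matrices of varying size for the network;
   points of the domain have type real ^ 'd. *)

section \<open>Domain\<close>

(* The condition interior (closure D) = D says that D lies on one side of its boundary only
   (no slits), so that a domain is determined by a mesh of its closure. *)
definition polygonal_domain :: "(real ^ 'd) set \<Rightarrow> bool" where
  "polygonal_domain D \<longleftrightarrow>
     open D \<and> connected D \<and> bounded D \<and> D \<noteq> {} \<and> interior (closure D) = D \<and>
     (\<exists>\<S>. finite \<S> \<and> (\<forall>S\<in>\<S>. polytope S \<and> aff_dim S = int CARD('d) - 1) \<and>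
          frontier D = \<Union>\<S>)"

section \<open>Reference cells and polynomials\<close>

(* Simplicial: triangles and tetrahedra; Tensor: quadrilaterals and hexahedra. *)
datatype cell_kind = Simplicial | Tensor

fun ref_cell :: "cell_kind \<Rightarrow> (real ^ 'd) set" where
  "ref_cell Simplicial = {x. (\<forall>i. 0 \<le> x $ i) \<and> (\<Sum>i\<in>UNIV. x $ i) \<le> 1}"
| "ref_cell Tensor = {x. \<forall>i. 0 \<le> x $ i \<and> x $ i \<le> 1}"

fun multi_indices :: "cell_kind \<Rightarrow> nat \<Rightarrow> ('d::finite \<Rightarrow> nat) set" where
  "multi_indices Simplicial r = {\<alpha>. (\<Sum>i\<in>UNIV. \<alpha> i) \<le> r}"
| "multi_indices Tensor r = {\<alpha>. \<forall>i. \<alpha> i \<le> r}"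

definition ref_polys :: "cell_kind \<Rightarrow> nat \<Rightarrow> (real ^ 'd \<Rightarrow> real) set" where
  "ref_polys k r =
     {p. \<exists>c. p = (\<lambda>x. \<Sum>\<alpha>\<in>multi_indices k r. c \<alpha> * (\<Prod>i\<in>UNIV. (x $ i) ^ \<alpha> i))}"

definition ref_nodes :: "cell_kind \<Rightarrow> nat \<Rightarrow> (real ^ 'd) set" where
  "ref_nodes k r = {x \<in> ref_cell k. \<forall>i. \<exists>m::nat. x $ i = real m / real r}"

section \<open>Meshes\<close>

(* A mesh is represented by the set of the reference maps F of its cells; the closed cell is
   the image F ` ref_cell k. *)
type_synonym 'd mesh = "(real ^ 'd \<Rightarrow> real ^ 'd) set"

definition mesh_width :: "cell_kind \<Rightarrow> 'd::finite mesh \<Rightarrow> real" where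
  "mesh_width k M = Max ((\<lambda>F. diameter (F ` ref_cell k)) ` M)"

(* Degree one makes F affine on simplices and multilinear on quadrilaterals and hexahedra.
   The last conjunct is structural regularity: two different cells meet in a common vertex,
   edge or face, or not at all (the empty set is a face in the sense of face_of). *)
definition conforming_mesh :: "cell_kind \<Rightarrow> (real ^ 'd) set \<Rightarrow> 'd::finite mesh \<Rightarrow> bool" where
  "conforming_mesh k D M \<longleftrightarrow>
     finite M \<and>
     (\<forall>F\<in>M. (\<forall>i. (\<lambda>x. F x $ i) \<in> ref_polys k 1) \<and> inj_on F (ref_cell k)) \<and>
     (\<Union>F\<in>M. F ` ref_cell k) = closure D \<and>
     (\<forall>F\<in>M. \<forall>G\<in>M. F \<noteq> G \<longrightarrow>
        (\<exists>A B. A face_of ref_cell k \<and> A \<noteq> ref_cell k \<and> B face_of ref_cell k \<and> B \<noteq> ref_cell k \<and>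
               F ` ref_cell k \<inter> G ` ref_cell k = F ` A \<and>
               F ` ref_cell k \<inter> G ` ref_cell k = G ` B))"

(* The Jacobian of F is bounded by kappa h_T and its inverse by kappa / h_T. For affine F this
   amounts to a bound on the ratio of the diameter and the inradius of the simplex. *)
definition shape_regular :: "cell_kind \<Rightarrow> real \<Rightarrow> 'd::finite mesh \<Rightarrow> bool" where
  "shape_regular k \<kappa> M \<longleftrightarrow>
     (\<forall>F\<in>M. \<forall>\<xi>\<in>ref_cell k. \<forall>v.
        norm (frechet_derivative F (at \<xi>) v) \<le> \<kappa> * diameter (F ` ref_cell k) * norm v \<and>
        diameter (F ` ref_cell k) * norm v \<le> \<kappa> * norm (frechet_derivative F (at \<xi>) v))"

definition quasi_uniform :: "cell_kind \<Rightarrow> real \<Rightarrow> 'd::finite mesh \<Rightarrow> bool" where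
  "quasi_uniform k q M \<longleftrightarrow> (\<forall>F\<in>M. mesh_width k M \<le> q * diameter (F ` ref_cell k))"

(* The maps of the reference cell onto its 2^d children. On simplices this is red refinement,
   in the form of the edgewise (Freudenthal) subdivision: for an ordering v 0, ..., v d of the
   vertices, the vertices of a child are midpoints of v a and v b, where a runs monotonically
   from 0 to some m and b from m to d and each step increments exactly one of them; S is the
   set of the steps incrementing a, and m = card S. The choice of the ordering is the choice of
   the interior diagonal in a tetrahedron. *)
fun subdivisions :: "cell_kind \<Rightarrow> 'd::finite mesh set" where
  "subdivisions Simplicial =
     {{s. linear (\<lambda>x. s x - s 0) \<and>
          (\<exists>S \<subseteq> {..<CARD('d)}. \<forall>j\<le>CARD('d).
             s (v j) = (1/2) *\<^sub>R (v (card (S \<inter> {..<j})) + v (card S + card ({..<j} - S))))}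
      | v :: nat \<Rightarrow> real ^ 'd.
        bij_betw v {..CARD('d)} (insert 0 (range (\<lambda>i. axis i 1)))}"
| "subdivisions Tensor = {{\<lambda>x. (1/2) *\<^sub>R (x + b) | b. \<forall>i. b $ i = 0 \<or> b $ i = 1}}"

definition uniform_refinement :: "cell_kind \<Rightarrow> 'd::finite mesh \<Rightarrow> 'd mesh \<Rightarrow> bool" where
  "uniform_refinement k M M' \<longleftrightarrow>
     (\<exists>C. (\<forall>F\<in>M. C F \<in> subdivisions k) \<and> M' = (\<Union>F\<in>M. (\<lambda>s. F \<circ> s) ` C F))"

definition mesh_hierarchy ::
    "cell_kind \<Rightarrow> (real ^ 'd) set \<Rightarrow> real \<Rightarrow> nat \<Rightarrow> (nat \<Rightarrow> 'd::finite mesh) \<Rightarrow> bool" where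
  "mesh_hierarchy k D \<kappa> n M \<longleftrightarrow>
     (\<forall>j\<le>n. conforming_mesh k D (M j) \<and> shape_regular k \<kappa> (M j)) \<and>
     (\<forall>j<n. uniform_refinement k (M j) (M (Suc j)))"

(* "Diameter of order h_P" is made quantitative by the constant a. *)
definition is_patch :: "cell_kind \<Rightarrow> real \<Rightarrow> 'd::finite mesh \<Rightarrow> (real ^ 'd) set \<Rightarrow> bool" where
  "is_patch k a M P \<longleftrightarrow>
     connected P \<and>
     (\<exists>C\<subseteq>M. C \<noteq> {} \<and> P = interior (\<Union>F\<in>C. F ` ref_cell k)) \<and>
     diameter P \<le> a * mesh_width k M \<and> mesh_width k M \<le> a * diameter P"

section \<open>Finite element spaces\<close>

(* The polynomial condition is pulled back to the reference cell. On simplices and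
   parallelepipeds this is the same as the condition on the cell itself; on general
   quadrilaterals and hexahedra it is the usual meaning of tensor-product polynomials. Only the
   values of the functions on the closure of D matter. *)
definition fe_space ::
    "cell_kind \<Rightarrow> nat \<Rightarrow> (real ^ 'd) set \<Rightarrow> 'd::finite mesh \<Rightarrow> (real ^ 'd \<Rightarrow> real) set" where
  "fe_space k r D M =
     {\<phi>. continuous_on (closure D) \<phi> \<and>
         (\<forall>F\<in>M. \<exists>p\<in>ref_polys k r. \<forall>\<xi>\<in>ref_cell k. \<phi> (F \<xi>) = p \<xi>) \<and>
         (\<forall>x\<in>frontier D. \<phi> x = 0)}"

(* The restrictions to the closure of P, extended by 0 to total functions. They form a
   subspace, so taking the span adds nothing. *)
definition local_space ::
    "(real ^ 'd) set \<Rightarrow> (real ^ 'd \<Rightarrow> real) set \<Rightarrow> (real ^ 'd \<Rightarrow> real) set" where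
  "local_space P V = (\<lambda>\<phi> x. if x \<in> closure P then \<phi> x else 0) ` V"

(* The nodes are those carrying the degrees of freedom of fe_space: because of the homogeneous
   boundary condition, Lagrange nodes on the boundary of the (open) domain D are not among
   them. *)
definition patch_nodes ::
    "cell_kind \<Rightarrow> nat \<Rightarrow> (real ^ 'd) set \<Rightarrow> 'd::finite mesh \<Rightarrow> (real ^ 'd) set \<Rightarrow> (real ^ 'd) set" where
  "patch_nodes k r D M P = (\<Union>F\<in>M. F ` ref_nodes k r) \<inter> D \<inter> closure P"

definition nodal_basis ::
    "(real ^ 'd \<Rightarrow> real) set \<Rightarrow> (real ^ 'd) list \<Rightarrow> (nat \<Rightarrow> real ^ 'd \<Rightarrow> real) \<Rightarrow> bool" where
  "nodal_basis V xs \<phi> \<longleftrightarrow>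
     (\<forall>j<length xs. \<phi> j \<in> V \<and> (\<forall>i<length xs. \<phi> j (xs ! i) = (if i = j then 1 else 0)))"

definition lagrange_interpolant ::
    "(real ^ 'd \<Rightarrow> real) set \<Rightarrow> (real ^ 'd) set \<Rightarrow> (real ^ 'd \<Rightarrow> real) \<Rightarrow> real ^ 'd \<Rightarrow> real" where
  "lagrange_interpolant V X g = (THE v. v \<in> V \<and> (\<forall>x\<in>X. v x = g x))"

(* Classical gradient. Finite element functions are differentiable in the interior of every
   cell, that is almost everywhere, and there it is their weak gradient. *)
definition grad :: "(real ^ 'd \<Rightarrow> real) \<Rightarrow> real ^ 'd \<Rightarrow> real ^ 'd" where
  "grad \<phi> x = (THE g. gderiv \<phi> x g)"

definition L2_norm :: "(real ^ 'd) set \<Rightarrow> (real ^ 'd \<Rightarrow> 'b::real_normed_vector) \<Rightarrow> real" where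
  "L2_norm S g = sqrt (LINT x:S|lebesgue. (norm (g x))\<^sup>2)"

definition galerkin_solution ::
    "(real ^ 'd) set \<Rightarrow> (real ^ 'd \<Rightarrow> real) set \<Rightarrow> (real ^ 'd \<Rightarrow> real) \<Rightarrow> (real ^ 'd \<Rightarrow> real) \<Rightarrow> bool" where
  "galerkin_solution D V f u \<longleftrightarrow>
     u \<in> V \<and>
     (\<forall>\<phi>\<in>V. (LINT x:D|lebesgue. inner (grad u x) (grad \<phi> x)) = (LINT x:D|lebesgue. f x * \<phi> x))"

section \<open>Neural networks\<close>

(* A layer is a pair of its weight matrix and its bias vector. *)
type_synonym layer = "real Matrix.mat \<times> real Matrix.vec"

definition layer_map :: "layer \<Rightarrow> real Matrix.vec \<Rightarrow> real Matrix.vec" where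
  "layer_map l x = mult_mat_vec (fst l) x + snd l"

(* Layers from N0-dimensional inputs to NL-dimensional outputs with matching dimensions;
   there is at least one layer. *)
fun network :: "nat \<Rightarrow> nat \<Rightarrow> layer list \<Rightarrow> bool" where
  "network N0 NL [] \<longleftrightarrow> False"
| "network N0 NL [l] \<longleftrightarrow> fst l \<in> carrier_mat NL N0 \<and> snd l \<in> carrier_vec NL"
| "network N0 NL (l # l' # ls) \<longleftrightarrow>
     (\<exists>N1. fst l \<in> carrier_mat N1 N0 \<and> snd l \<in> carrier_vec N1 \<and> network N1 NL (l' # ls))"

fun mlp :: "(real \<Rightarrow> real) \<Rightarrow> layer list \<Rightarrow> real Matrix.vec \<Rightarrow> real Matrix.vec" where
  "mlp \<sigma> [] x = x"
| "mlp \<sigma> [l] x = layer_map l x"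
| "mlp \<sigma> (l # l' # ls) x = mlp \<sigma> (l' # ls) (map_vec \<sigma> (layer_map l x))"

definition euclidean_norm :: "real Matrix.vec \<Rightarrow> real" where
  "euclidean_norm x = sqrt (scalar_prod x x)"

definition lipschitz_network ::
    "nat \<Rightarrow> real \<Rightarrow> (real Matrix.vec \<Rightarrow> real Matrix.vec) \<Rightarrow> bool" where
  "lipschitz_network N0 L \<N> \<longleftrightarrow>
     0 \<le> L \<and>
     (\<forall>x\<in>carrier_vec N0. \<forall>y\<in>carrier_vec N0.
        euclidean_norm (\<N> x - \<N> y) \<le> L * euclidean_norm (x - y))"

definition network_input ::
    "(real ^ 'd) list \<Rightarrow> (real ^ 'd) list \<Rightarrow> (real ^ 'd \<Rightarrow> real) \<Rightarrow> (real ^ 'd \<Rightarrow> real) \<Rightarrow> real Matrix.vec" where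
  "network_input xsH xsh u f = vec_of_list (map u xsH @ map f xsh)"

definition network_update ::
    "(nat \<Rightarrow> real ^ 'd \<Rightarrow> real) \<Rightarrow> real Matrix.vec \<Rightarrow> real ^ 'd \<Rightarrow> real" where
  "network_update \<phi> y x = (\<Sum>j<dim_vec y. vec_index y j * \<phi> j x)"

end

theory Submission
  imports Defs
begin

text \<open>
  The difference $v$ of the two updates is the combination of the nodal basis functions with coefficients
  $y_j - y'_j$, where $y$ and $y'$ are the two network outputs. Thus $v$ lies in the fine local space and
  its nodal values are $y_j - y'_j$. The proof compares norms of finite element functions with the
  Euclidean norms of their nodal values, in both directions.

  An inverse estimate bounds the gradient: $\<parallel>\<nabla>v\<parallel>^2$ is at most a constant times $h^{d-2}$ times the sum
  of $v(x)^2$ over the fine nodes (\<open>L2_norm_grad_le_nodal_sum\<close>). The Lipschitz property of the network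
  bounds that sum by $L^2$ times the squared distance of the inputs, which is the sum of
  $(u_H - u_H^i)(x)^2$ over the coarse nodes and of $(f - f_i)(x)^2$ over the fine nodes. The latter are
  also the nodal values of the interpolant of $f - f_i$. Conversely, $H^d$ times the sum of the squared
  nodal values of a finite element function is at most a constant times its squared $L^2$ norm
  (\<open>nodal_sum_le_L2_norm\<close>). Since $h \<le> H$, the factor $h^d$ left over from the inverse estimate is
  absorbed by both sums, and $h^{-2} L^2$ remains.

  Both estimates reduce to the reference cell, where a polynomial and its derivative are bounded by
  the values at the lattice nodes (\<open>ref_poly_bounded_by_nodal_values\<close>). They are carried over to the
  cells by comparing balls: a cell map $G$ is injective with $|DG v| \<ge> m |v|$, where $m$ is comparable to $h$,
  and therefore the image of a ball of radius $\<rho>$ contains a ball of radius $m\<rho>$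
  (\<open>ball_subset_image_ball\<close>). Hence a polynomial that is large at a point of a cell is large on a ball
  of radius comparable to $h$ inside that cell; and as disjoint balls of such a radius sit in the cells, only a bounded
  number of cells comes near a given point (\<open>card_cells_near_le_overlap\<close>). This number controls
  how often a node is counted when sums over cells are compared with sums over nodes.

  A patch is built from cells of the coarsest mesh, while the estimates are summed over cells of finer
  meshes. Every finer mesh contains a set of cells that tiles the patch (\<open>patch_tiled_by_finer_cells\<close>):
  each fine cell lies in a coarse cell, and no other coarse cell meets the interior of a given one, so
  the fine cells that cover this interior all lie in that coarse cell.
\<close>

(* The infix symbol is kept for the components of points of the domain; the entries of the vectors
   of the network are written with vec_index. *)
no_notation vec_index (infixl "$" 100)

section \<open>Polynomials on the reference cell\<close>

lemma finite_multi_indices: "finite (multi_indices k r :: ('d::finite \<Rightarrow> nat) set)"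
proof -
  have fin: "finite {\<alpha> :: 'd \<Rightarrow> nat. \<forall>i. \<alpha> i \<le> r}"
  proof -
    have "{\<alpha> :: 'd \<Rightarrow> nat. \<forall>i. \<alpha> i \<le> r} = PiE UNIV (\<lambda>_. {..r})"
      by (auto simp: PiE_UNIV_domain)
    then show ?thesis
      by (simp add: finite_PiE)
  qed
  have "multi_indices k r \<subseteq> {\<alpha> :: 'd \<Rightarrow> nat. \<forall>i. \<alpha> i \<le> r}"
  proof (cases k)
    case Simplicial
    have "\<alpha> i \<le> r" if "(\<Sum>i\<in>UNIV. \<alpha> i) \<le> r" for \<alpha> :: "'d \<Rightarrow> nat" and i
      using that member_le_sum[of i UNIV \<alpha>] by simp
    then show ?thesis
      using Simplicial by auto
  qed auto
  then show ?thesis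
    using fin by (rule finite_subset)
qed

lemma multi_indices_downward:
  assumes "\<alpha> \<in> multi_indices k r" "\<And>i. \<beta> i \<le> \<alpha> i"
  shows "\<beta> \<in> multi_indices k r"
  using assms sum_mono[of UNIV \<beta> \<alpha>] by (cases k) (auto intro: order_trans)

text \<open>The factors vanish at $0, 1/r, \<dots>, (b-1)/r$. In the Newton basis the interpolation problem at the
  lattice nodes is therefore triangular, for simplices and for cubes alike, since in both cases the index
  set is closed downwards and the nodes are the multi-indices divided by $r$.\<close>

definition newton :: "nat \<Rightarrow> nat \<Rightarrow> real \<Rightarrow> real" where
  "newton r b t = (\<Prod>m<b. real r * t - real m)"

definition newton_prod :: "nat \<Rightarrow> ('d::finite \<Rightarrow> nat) \<Rightarrow> real ^ 'd \<Rightarrow> real" where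
  "newton_prod r \<beta> x = (\<Prod>i\<in>UNIV. newton r (\<beta> i) (x $ i))"

lemma power_eq_newton_sum:
  assumes "r \<ge> 1"
  shows "\<exists>s. \<forall>t. t ^ a = (\<Sum>b\<le>a. s b * newton r b t)"
proof (induction a)
  case 0
  show ?case
    by (intro exI[of _ "\<lambda>_. 1"]) (simp add: newton_def)
next
  case (Suc a)
  then obtain s where s: "\<And>t. t ^ a = (\<Sum>b\<le>a. s b * newton r b t)"
    by blast
  \<comment> \<open>The coefficients arise from $t N_b = (N_{b+1} + b N_b) / r$ for the Newton polynomials $N_b$.\<close>
  define u where "u b = (if b = 0 then 0 else s (b - 1) / r) + (if b \<le> a then s b * b / r else 0)" for b :: nat
  have step: "t * newton r b t = newton r (Suc b) t / r + real b / r * newton r b t" for t b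
    using assms by (simp add: newton_def field_simps)
  have "t ^ Suc a = (\<Sum>b\<le>Suc a. u b * newton r b t)" for t
  proof -
    have "t ^ Suc a = (\<Sum>b\<le>a. s b * (t * newton r b t))"
      using s[of t] by (simp add: sum_distrib_left mult_ac)
    also have "\<dots> = (\<Sum>b\<le>a. s b / r * newton r (Suc b) t) + (\<Sum>b\<le>a. s b * b / r * newton r b t)"
      unfolding step by (simp add: algebra_simps sum.distrib)
    also have "(\<Sum>b\<le>a. s b / r * newton r (Suc b) t)
        = (\<Sum>b\<le>Suc a. (if b = 0 then 0 else s (b - 1) / r) * newton r b t)"
      by (subst sum.atMost_Suc_shift) simp
    also have "(\<Sum>b\<le>a. s b * b / r * newton r b t)
        = (\<Sum>b\<le>Suc a. (if b \<le> a then s b * b / r else 0) * newton r b t)"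
      by simp
    also have "(\<Sum>b\<le>Suc a. (if b = 0 then 0 else s (b - 1) / r) * newton r b t)
        + (\<Sum>b\<le>Suc a. (if b \<le> a then s b * b / r else 0) * newton r b t)
        = (\<Sum>b\<le>Suc a. u b * newton r b t)"
      by (simp only: u_def sum.distrib[symmetric] distrib_right)
    finally show ?thesis .
  qed
  then show ?case
    by blast
qed

lemma ref_polys_newton_expansion:
  fixes p :: "real ^ 'd \<Rightarrow> real"
  assumes r: "r \<ge> 1" and p: "p \<in> ref_polys k r"
  shows "\<exists>d. \<forall>x. p x = (\<Sum>\<beta>\<in>multi_indices k r. d \<beta> * newton_prod r \<beta> x)"
proof -
  let ?J = "multi_indices k r :: ('d \<Rightarrow> nat) set"
  obtain c where c: "p = (\<lambda>x. \<Sum>\<alpha>\<in>?J. c \<alpha> * (\<Prod>i\<in>UNIV. (x $ i) ^ \<alpha> i))"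
    using p unfolding ref_polys_def by blast
  obtain s where s: "\<And>a t. t ^ a = (\<Sum>b\<le>a. s a b * newton r b t)"
    using power_eq_newton_sum[OF r] by metis
  define e where "e \<alpha> \<beta> = (if \<beta> \<in> PiE UNIV (\<lambda>i. {..\<alpha> i}) then \<Prod>i\<in>UNIV. s (\<alpha> i) (\<beta> i) else 0)"
    for \<alpha> \<beta> :: "'d \<Rightarrow> nat"
  have monom: "(\<Prod>i\<in>UNIV. (x $ i) ^ \<alpha> i) = (\<Sum>\<beta>\<in>?J. e \<alpha> \<beta> * newton_prod r \<beta> x)" if "\<alpha> \<in> ?J" for \<alpha> x
  proof -
    have sub: "PiE UNIV (\<lambda>i. {..\<alpha> i}) \<subseteq> ?J"
      using multi_indices_downward[OF that] by (auto simp: PiE_UNIV_domain)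
    have "(\<Prod>i\<in>UNIV. (x $ i) ^ \<alpha> i) = (\<Prod>i\<in>UNIV. \<Sum>b\<le>\<alpha> i. s (\<alpha> i) b * newton r b (x $ i))"
      using s by simp
    also have "\<dots> = (\<Sum>\<beta>\<in>PiE UNIV (\<lambda>i. {..\<alpha> i}). \<Prod>i\<in>UNIV. s (\<alpha> i) (\<beta> i) * newton r (\<beta> i) (x $ i))"
      by (rule prod_sum_PiE) auto
    also have "\<dots> = (\<Sum>\<beta>\<in>PiE UNIV (\<lambda>i. {..\<alpha> i}). e \<alpha> \<beta> * newton_prod r \<beta> x)"
      by (rule sum.cong) (auto simp: e_def newton_prod_def prod.distrib)
    also have "\<dots> = (\<Sum>\<beta>\<in>?J. e \<alpha> \<beta> * newton_prod r \<beta> x)"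
      by (rule sum.mono_neutral_left) (use sub finite_multi_indices in \<open>auto simp: e_def\<close>)
    finally show ?thesis .
  qed
  have "p x = (\<Sum>\<beta>\<in>?J. (\<Sum>\<alpha>\<in>?J. c \<alpha> * e \<alpha> \<beta>) * newton_prod r \<beta> x)" for x
  proof -
    have "p x = (\<Sum>\<alpha>\<in>?J. \<Sum>\<beta>\<in>?J. c \<alpha> * e \<alpha> \<beta> * newton_prod r \<beta> x)"
      unfolding c by (rule sum.cong) (auto simp: monom sum_distrib_left mult_ac)
    also have "\<dots> = (\<Sum>\<beta>\<in>?J. (\<Sum>\<alpha>\<in>?J. c \<alpha> * e \<alpha> \<beta>) * newton_prod r \<beta> x)"
      by (subst sum.swap) (simp add: sum_distrib_right)
    finally show ?thesis .
  qed
  then show ?thesis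
    by (intro exI[of _ "\<lambda>\<beta>. \<Sum>\<alpha>\<in>?J. c \<alpha> * e \<alpha> \<beta>"]) simp
qed

definition lattice_node :: "nat \<Rightarrow> ('d::finite \<Rightarrow> nat) \<Rightarrow> real ^ 'd" where
  "lattice_node r \<gamma> = (\<chi> i. real (\<gamma> i) / real r)"

lemma ref_nodes_eq_lattice:
  assumes "r \<ge> 1"
  shows "(ref_nodes k r :: (real ^ 'd) set) = lattice_node r ` multi_indices k r"
proof -
  have mem: "lattice_node r \<gamma> \<in> ref_cell k \<longleftrightarrow> \<gamma> \<in> multi_indices k r" for \<gamma> :: "'d \<Rightarrow> nat"
    using assms
    by (cases k) (auto simp: lattice_node_def sum_divide_distrib[symmetric] divide_le_eq_1 
        simp flip: of_nat_sum)
  have "x \<in> lattice_node r ` multi_indices k r" if x: "x \<in> ref_nodes k r" for x :: "real ^ 'd"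
  proof -
    have "\<forall>i. \<exists>m::nat. x $ i = real m / real r" and cell: "x \<in> ref_cell k"
      using x by (auto simp: ref_nodes_def)
    then obtain \<gamma> :: "'d \<Rightarrow> nat" where "\<And>i. x $ i = real (\<gamma> i) / real r"
      by metis
    then have "x = lattice_node r \<gamma>"
      by (simp add: lattice_node_def Finite_Cartesian_Product.vec_eq_iff)
    with cell mem show ?thesis
      by blast
  qed
  moreover have "lattice_node r \<gamma> \<in> ref_nodes k r" if "\<gamma> \<in> multi_indices k r" for \<gamma> :: "'d \<Rightarrow> nat"
    using that mem[of \<gamma>] by (auto simp: ref_nodes_def lattice_node_def)
  ultimately show ?thesis
    by blast
qed

lemma newton_prod_eq_0:
  assumes "r \<ge> 1" "\<not> (\<forall>i. \<beta> i \<le> \<gamma> i)"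
  shows "newton_prod r \<beta> (lattice_node r \<gamma>) = 0"
proof -
  obtain i where "\<gamma> i < \<beta> i"
    using assms(2) by (auto simp: not_le)
  then have "newton r (\<beta> i) (lattice_node r \<gamma> $ i) = 0"
    using assms(1) by (auto simp: newton_def lattice_node_def intro!: prod_zero)
  then show ?thesis
    unfolding newton_prod_def by (intro prod_zero) auto
qed

lemma newton_prod_diagonal:
  assumes "r \<ge> 1"
  shows "newton_prod r \<beta> (lattice_node r \<beta>) \<ge> 1"
proof -
  have "newton r b (real b / real r) \<ge> 1" for b
    using assms unfolding newton_def by (intro prod_ge_1) auto
  then show ?thesis
    unfolding newton_prod_def by (intro prod_ge_1) (auto simp: lattice_node_def)
qed

text \<open>Evaluation at the node of $\<beta>$ involves only the coefficients with an index below $\<beta>$, and the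
  coefficient of $\<beta>$ itself with a factor of at least 1. Hence the coefficients are bounded one after
  the other, by induction on $|\<beta>|$; this is unisolvence in quantitative form.\<close>

lemma newton_coeffs_bounded_by_nodal_values:
  assumes r: "r \<ge> 1"
  shows "\<exists>C\<ge>0. \<forall>(d :: ('d::finite \<Rightarrow> nat) \<Rightarrow> real) m.
    (\<forall>\<nu>\<in>ref_nodes k r. \<bar>\<Sum>\<beta>\<in>multi_indices k r. d \<beta> * newton_prod r \<beta> \<nu>\<bar> \<le> m) \<longrightarrow>
    (\<forall>\<beta>\<in>multi_indices k r. \<bar>d \<beta>\<bar> \<le> C * m)"
proof -
  let ?J = "multi_indices k r :: ('d \<Rightarrow> nat) set"
  let ?N = "\<lambda>\<beta> \<gamma>. newton_prod r \<beta> (lattice_node r \<gamma>)"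
  let ?S = "\<lambda>\<beta> :: 'd \<Rightarrow> nat. \<Sum>i\<in>UNIV. \<beta> i"
  define A where "A = (\<Sum>\<gamma>\<in>?J. \<Sum>\<beta>\<in>?J. \<bar>?N \<beta> \<gamma>\<bar>)"
  have "\<exists>C\<ge>0. \<forall>(d :: ('d::finite \<Rightarrow> nat) \<Rightarrow> real) m.
    (\<forall>\<gamma>\<in>?J. \<bar>\<Sum>\<beta>\<in>?J. d \<beta> * ?N \<beta> \<gamma>\<bar> \<le> m) \<longrightarrow>
    (\<forall>\<beta>\<in>?J. ?S \<beta> < n \<longrightarrow> \<bar>d \<beta>\<bar> \<le> C * m)" for n
  proof (induction n)
    case 0
    show ?case
      by auto
  next
    case (Suc n)
    then obtain C where C: "C \<ge> 0" and bound: "\<And>d m \<beta>. (\<forall>\<gamma>\<in>?J. \<bar>\<Sum>\<beta>\<in>?J. d \<beta> * ?N \<beta> \<gamma>\<bar> \<le> m)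
      \<Longrightarrow> \<beta> \<in> ?J \<Longrightarrow> ?S \<beta> < n \<Longrightarrow> \<bar>d \<beta>\<bar> \<le> C * m"
      by blast
    have "\<bar>d \<beta>\<bar> \<le> (C + (1 + C * A)) * m"
      if m: "\<forall>\<gamma>\<in>?J. \<bar>\<Sum>\<beta>\<in>?J. d \<beta> * ?N \<beta> \<gamma>\<bar> \<le> m" and \<beta>: "\<beta> \<in> ?J" "?S \<beta> < Suc n" for d m \<beta>
    proof -
      have m0: "m \<ge> 0"
        using m \<beta>(1) by (meson abs_ge_zero order_trans)
      have A0: "A \<ge> 0"
        by (simp add: A_def sum_nonneg)
      show ?thesis
      proof (cases "?S \<beta> < n")
        case True
        then have "\<bar>d \<beta>\<bar> \<le> C * m"
          using bound m \<beta> by blast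
        moreover have "0 \<le> (1 + C * A) * m"
          using C A0 m0 by simp
        ultimately show ?thesis
          by (simp add: distrib_right)
      next
        case False
        \<comment> \<open>Solve the equation at the node of $\<beta>$ for the coefficient of $\<beta>$; terms that are not below
        $\<beta>$ vanish, those below are bounded by the induction hypothesis, and $A$ bounds their weights.\<close>
        define rest where "rest = (\<Sum>\<gamma>\<in>?J - {\<beta>}. d \<gamma> * ?N \<gamma> \<beta>)"
        have term_le: "\<bar>d \<gamma> * ?N \<gamma> \<beta>\<bar> \<le> C * m * \<bar>?N \<gamma> \<beta>\<bar>" if \<gamma>: "\<gamma> \<in> ?J - {\<beta>}" for \<gamma>
        proof (cases "\<forall>i. \<gamma> i \<le> \<beta> i")
          case True
          obtain i where "\<gamma> i \<noteq> \<beta> i"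
            using \<gamma> by auto
          with True have "?S \<gamma> < ?S \<beta>"
            by (intro sum_strict_mono_ex1) (auto simp: order.strict_iff_order)
          then have "\<bar>d \<gamma>\<bar> \<le> C * m"
            using bound[OF m] \<gamma> \<beta>(2) by auto
          then show ?thesis
            by (simp add: abs_mult mult_right_mono)
        next
          case False
          then show ?thesis
            using newton_prod_eq_0[OF r False] by simp
        qed
        have "\<bar>rest\<bar> \<le> (\<Sum>\<gamma>\<in>?J - {\<beta>}. \<bar>d \<gamma> * ?N \<gamma> \<beta>\<bar>)"
          unfolding rest_def by (rule sum_abs)
        also have "\<dots> \<le> (\<Sum>\<gamma>\<in>?J - {\<beta>}. C * m * \<bar>?N \<gamma> \<beta>\<bar>)"
          by (rule sum_mono) (rule term_le)
        also have "\<dots> \<le> (\<Sum>\<gamma>\<in>?J. C * m * \<bar>?N \<gamma> \<beta>\<bar>)"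
          using C m0 finite_multi_indices by (intro sum_mono2) auto
        also have "\<dots> = C * m * (\<Sum>\<gamma>\<in>?J. \<bar>?N \<gamma> \<beta>\<bar>)"
          by (simp add: sum_distrib_left)
        also have "\<dots> \<le> C * m * A"
          unfolding A_def using C m0 \<beta>(1) finite_multi_indices
          by (intro mult_left_mono member_le_sum[of \<beta> _ "\<lambda>\<gamma>. \<Sum>\<beta>\<in>?J. \<bar>?N \<beta> \<gamma>\<bar>"]) (auto simp: sum_nonneg)
        finally have rest: "\<bar>rest\<bar> \<le> C * m * A" .
        have "(\<Sum>\<gamma>\<in>?J. d \<gamma> * ?N \<gamma> \<beta>) = d \<beta> * ?N \<beta> \<beta> + rest"
          unfolding rest_def using \<beta>(1) finite_multi_indices by (intro sum.remove) auto
        then have "\<bar>d \<beta> * ?N \<beta> \<beta>\<bar> \<le> m + C * m * A"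
          using m \<beta>(1) rest by fastforce
        moreover have "\<bar>d \<beta>\<bar> \<le> \<bar>d \<beta> * ?N \<beta> \<beta>\<bar>"
          using newton_prod_diagonal[OF r, of \<beta>] mult_left_mono[of 1 "?N \<beta> \<beta>" "\<bar>d \<beta>\<bar>"]
          by (simp add: abs_mult)
        moreover have "0 \<le> C * m"
          using C m0 by simp
        ultimately show ?thesis
          by (simp add: algebra_simps)
      qed
    qed
    moreover have "A \<ge> 0"
      by (simp add: A_def sum_nonneg)
    ultimately show ?case
      using C by (intro exI[of _ "C + (1 + C * A)"]) auto
  qed
  from this[of "Suc (\<Sum>\<beta>\<in>?J. ?S \<beta>)"] obtain C where "C \<ge> 0"
    and C: "\<And>d m \<beta>. (\<forall>\<gamma>\<in>?J. \<bar>\<Sum>\<beta>\<in>?J. d \<beta> * ?N \<beta> \<gamma>\<bar> \<le> m)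
      \<Longrightarrow> \<beta> \<in> ?J \<Longrightarrow> ?S \<beta> < Suc (\<Sum>\<beta>\<in>?J. ?S \<beta>) \<Longrightarrow> \<bar>d \<beta>\<bar> \<le> C * m"
    by blast
  have "?S \<beta> < Suc (\<Sum>\<beta>\<in>?J. ?S \<beta>)" if "\<beta> \<in> ?J" for \<beta>
    using member_le_sum[of \<beta> ?J ?S] that by (simp add: less_Suc_eq_le finite_multi_indices)
  with C \<open>C \<ge> 0\<close> show ?thesis
    unfolding ref_nodes_eq_lattice[OF r] by (intro exI[of _ C]) auto
qed

lemma bounded_ref_cell: "bounded (ref_cell k :: (real ^ 'd) set)"
proof -
  have "x $ i \<le> 1" if "\<forall>i. 0 \<le> x $ i" "(\<Sum>i\<in>UNIV. x $ i) \<le> 1" for x :: "real ^ 'd" and i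
    using that member_le_sum[of i UNIV "\<lambda>i. x $ i"] by simp
  then have "ref_cell k \<subseteq> (cbox 0 1 :: (real ^ 'd) set)"
    by (cases k) (auto simp: mem_box_cart)
  then show ?thesis
    using bounded_cbox bounded_subset by blast
qed

lemma ref_cell_le_1:
  assumes "x \<in> ref_cell k"
  shows "\<bar>x $ i\<bar> \<le> 1"
  using assms member_le_sum[of i UNIV "\<lambda>i. x $ i"] by (cases k) auto

lemma closed_ref_cell: "closed (ref_cell k :: (real ^ 'd) set)"
  by (cases k) (auto intro!: closed_Collect_conj closed_Collect_all closed_Collect_le continuous_intros)

lemma compact_ref_cell: "compact (ref_cell k :: (real ^ 'd) set)"
  using bounded_ref_cell closed_ref_cell compact_eq_bounded_closed by blast

lemma convex_ref_cell: "convex (ref_cell k :: (real ^ 'd) set)"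
proof (rule convexI)
  fix x y :: "real ^ 'd" and u v :: real
  assume xy: "x \<in> ref_cell k" "y \<in> ref_cell k" and uv: "0 \<le> u" "0 \<le> v" "u + v = 1"
  show "u *\<^sub>R x + v *\<^sub>R y \<in> ref_cell k"
    using xy uv
    by (cases k) (auto simp: sum.distrib sum_distrib_left[symmetric] intro!: convex_bound_le)
qed

text \<open>A ball that lies in the simplex as well as in the cube, so that both kinds of cells can be treated
  by the same argument.\<close>

lemma ball_subset_ref_cell:
  "ball (\<chi> i. 1 / (2 * real CARD('d))) (1 / (2 * real CARD('d))) \<subseteq> (ref_cell k :: (real ^ 'd) set)"
proof
  let ?\<delta> = "1 / (2 * real CARD('d))"
  fix x :: "real ^ 'd"
  assume x: "x \<in> ball (\<chi> i. ?\<delta>) ?\<delta>"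
  have i: "0 \<le> x $ i \<and> x $ i \<le> 2 * ?\<delta>" for i
  proof -
    have "\<bar>((\<chi> i. ?\<delta>) - x) $ i\<bar> < ?\<delta>"
      using component_le_norm_cart[of "(\<chi> i. ?\<delta>) - x" i] x by (simp add: dist_norm)
    then show ?thesis
      unfolding vector_minus_component vec_lambda_beta by linarith
  qed
  have "(\<Sum>i\<in>UNIV. x $ i) \<le> (\<Sum>i\<in>(UNIV::'d set). 2 * ?\<delta>)"
    using i by (intro sum_mono) blast
  moreover have "2 * ?\<delta> \<le> 1"
    by (simp add: Suc_leI)
  moreover have "x $ i \<le> 1" for i
    using i[of i] \<open>2 * ?\<delta> \<le> 1\<close> by linarith
  ultimately show "x \<in> ref_cell k"
    using i by (cases k) simp_all
qed

lemma interior_ref_cell_nonempty: "interior (ref_cell k :: (real ^ 'd) set) \<noteq> {}"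
  using interior_maximal[OF ball_subset_ref_cell[of k, where 'd='d] open_ball] by force

lemma ref_cell_nonempty: "ref_cell k \<noteq> {}"
  using interior_ref_cell_nonempty[of k] interior_subset[of "ref_cell k"] by blast

lemma closure_interior_ref_cell: "closure (interior (ref_cell k)) = (ref_cell k :: (real ^ 'd) set)"
  by (simp add: convex_closure_interior[OF convex_ref_cell interior_ref_cell_nonempty] closed_ref_cell closure_closed)

definition C1_bounded_on :: "'a::real_normed_vector set \<Rightarrow> ('a \<Rightarrow> real) \<Rightarrow> bool" where
  "C1_bounded_on S f \<longleftrightarrow> (\<exists>B\<ge>0. \<exists>f'. \<forall>x\<in>S. \<bar>f x\<bar> \<le> B \<and> (f has_derivative f' x) (at x) \<and>
     (\<forall>w. \<bar>f' x w\<bar> \<le> B * norm w))"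

lemma C1_bounded_on_const: "C1_bounded_on S (\<lambda>_. c)"
  unfolding C1_bounded_on_def
  by (intro exI[of _ "\<bar>c\<bar>"] conjI exI[of _ "\<lambda>_ _. 0"]) auto

lemma C1_bounded_on_add:
  assumes "C1_bounded_on S f" "C1_bounded_on S g"
  shows "C1_bounded_on S (\<lambda>x. f x + g x)"
proof -
  obtain A f' where A: "A \<ge> 0" "\<And>x. x \<in> S \<Longrightarrow> \<bar>f x\<bar> \<le> A" "\<And>x. x \<in> S \<Longrightarrow> (f has_derivative f' x) (at x)"
    "\<And>x w. x \<in> S \<Longrightarrow> \<bar>f' x w\<bar> \<le> A * norm w"
    using assms(1) unfolding C1_bounded_on_def by metis
  obtain B g' where B: "B \<ge> 0" "\<And>x. x \<in> S \<Longrightarrow> \<bar>g x\<bar> \<le> B" "\<And>x. x \<in> S \<Longrightarrow> (g has_derivative g' x) (at x)"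
    "\<And>x w. x \<in> S \<Longrightarrow> \<bar>g' x w\<bar> \<le> B * norm w"
    using assms(2) unfolding C1_bounded_on_def by metis
  have "\<bar>f x + g x\<bar> \<le> A + B \<and> ((\<lambda>x. f x + g x) has_derivative (\<lambda>w. f' x w + g' x w)) (at x) \<and>
     (\<forall>w. \<bar>f' x w + g' x w\<bar> \<le> (A + B) * norm w)" if x: "x \<in> S" for x
  proof (intro conjI allI)
    show "\<bar>f x + g x\<bar> \<le> A + B"
      using A(2)[OF x] B(2)[OF x] by linarith
    show "((\<lambda>x. f x + g x) has_derivative (\<lambda>w. f' x w + g' x w)) (at x)"
      using A(3)[OF x] B(3)[OF x] by (rule has_derivative_add)
    show "\<bar>f' x w + g' x w\<bar> \<le> (A + B) * norm w" for w
      using A(4)[OF x, of w] B(4)[OF x, of w] unfolding distrib_right by linarith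
  qed
  then show ?thesis
    unfolding C1_bounded_on_def using A(1) B(1)
    by (intro exI[of _ "A + B"] conjI exI[of _ "\<lambda>x w. f' x w + g' x w"]) auto
qed

lemma C1_bounded_on_mult:
  assumes "C1_bounded_on S f" "C1_bounded_on S g"
  shows "C1_bounded_on S (\<lambda>x. f x * g x)"
proof -
  obtain A f' where A: "A \<ge> 0" "\<And>x. x \<in> S \<Longrightarrow> \<bar>f x\<bar> \<le> A" "\<And>x. x \<in> S \<Longrightarrow> (f has_derivative f' x) (at x)"
    "\<And>x w. x \<in> S \<Longrightarrow> \<bar>f' x w\<bar> \<le> A * norm w"
    using assms(1) unfolding C1_bounded_on_def by metis
  obtain B g' where B: "B \<ge> 0" "\<And>x. x \<in> S \<Longrightarrow> \<bar>g x\<bar> \<le> B" "\<And>x. x \<in> S \<Longrightarrow> (g has_derivative g' x) (at x)"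
    "\<And>x w. x \<in> S \<Longrightarrow> \<bar>g' x w\<bar> \<le> B * norm w"
    using assms(2) unfolding C1_bounded_on_def by metis
  have AB: "0 \<le> A * B"
    using A B by simp
  have "\<bar>f x * g x\<bar> \<le> A * B + A * B \<and> ((\<lambda>x. f x * g x) has_derivative (\<lambda>w. f x * g' x w + f' x w * g x)) (at x) \<and>
     (\<forall>w. \<bar>f x * g' x w + f' x w * g x\<bar> \<le> (A * B + A * B) * norm w)" if x: "x \<in> S" for x
  proof (intro conjI allI)
    have "\<bar>f x * g x\<bar> \<le> A * B"
      unfolding abs_mult using A(1) A(2)[OF x] B(2)[OF x] by (intro mult_mono) auto
    then show "\<bar>f x * g x\<bar> \<le> A * B + A * B"
      using AB by linarith
    show "((\<lambda>x. f x * g x) has_derivative (\<lambda>w. f x * g' x w + f' x w * g x)) (at x)"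
      using A(3)[OF x] B(3)[OF x] by (rule has_derivative_mult)
    show "\<bar>f x * g' x w + f' x w * g x\<bar> \<le> (A * B + A * B) * norm w" for w
    proof -
      have "\<bar>f x * g' x w\<bar> \<le> A * (B * norm w)"
        unfolding abs_mult using A(1) A(2)[OF x] B(4)[OF x, of w] by (intro mult_mono) auto
      moreover have "\<bar>f' x w * g x\<bar> \<le> (A * norm w) * B"
        unfolding abs_mult using A(1) A(4)[OF x, of w] B(2)[OF x] by (intro mult_mono) auto
      ultimately show ?thesis
        by (simp add: algebra_simps)
    qed
  qed
  then show ?thesis
    unfolding C1_bounded_on_def using AB
    by (intro exI[of _ "A * B + A * B"] conjI exI[of _ "\<lambda>x w. f x * g' x w + f' x w * g x"]) auto
qed

lemma C1_bounded_on_prod: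
  assumes "finite I" "\<And>i. i \<in> I \<Longrightarrow> C1_bounded_on S (f i)"
  shows "C1_bounded_on S (\<lambda>x. \<Prod>i\<in>I. f i x)"
  using assms by (induction I) (simp_all add: C1_bounded_on_const C1_bounded_on_mult)

lemma C1_bounded_on_component: "C1_bounded_on (ref_cell k) (\<lambda>x :: real ^ 'd. x $ i)"
  unfolding C1_bounded_on_def
proof (intro exI[of _ 1] conjI exI[of _ "\<lambda>_ w. w $ i"] ballI allI)
  show "((\<lambda>x. x $ i) has_derivative (\<lambda>w. w $ i)) (at x)" for x :: "real ^ 'd"
    by (intro bounded_linear_imp_has_derivative bounded_linear_vec_nth)
qed (auto simp: ref_cell_le_1 component_le_norm_cart)

lemma C1_bounded_on_newton_prod: "C1_bounded_on (ref_cell k) (newton_prod r \<beta> :: real ^ 'd \<Rightarrow> real)"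
proof -
  have "C1_bounded_on (ref_cell k) (\<lambda>x :: real ^ 'd. real r * (x $ i) + (- real m))" for i m
    by (intro C1_bounded_on_add C1_bounded_on_mult C1_bounded_on_const C1_bounded_on_component)
  then have "C1_bounded_on (ref_cell k) (\<lambda>x :: real ^ 'd. \<Prod>i\<in>UNIV. \<Prod>m<\<beta> i. real r * (x $ i) - real m)"
    by (intro C1_bounded_on_prod) simp_all
  then show ?thesis
    by (simp add: newton_prod_def[abs_def] newton_def)
qed

text \<open>For $m = 0$ the bound states that a polynomial vanishing at the lattice nodes is zero.\<close>

definition nodally_bounded :: "cell_kind \<Rightarrow> nat \<Rightarrow> real \<Rightarrow> (real ^ 'd \<Rightarrow> real) \<Rightarrow> bool" where
  "nodally_bounded k r C p \<longleftrightarrow> (\<exists>p'. \<forall>m.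
    (\<forall>\<nu>\<in>ref_nodes k r. \<bar>p \<nu>\<bar> \<le> m) \<longrightarrow>
    (\<forall>\<xi>\<in>ref_cell k. \<bar>p \<xi>\<bar> \<le> C * m \<and> (p has_derivative p' \<xi>) (at \<xi>) \<and> (\<forall>w. \<bar>p' \<xi> w\<bar> \<le> C * m * norm w)))"

text \<open>The Newton coefficients are controlled by the nodal values, and each of the finitely many Newton
  polynomials is bounded on the reference cell together with its derivative.\<close>

theorem ref_poly_bounded_by_nodal_values:
  assumes r: "r \<ge> 1"
  shows "\<exists>C\<ge>1. \<forall>p \<in> (ref_polys k r :: (real ^ 'd \<Rightarrow> real) set). nodally_bounded k r C p"
proof -
  let ?J = "multi_indices k r :: ('d \<Rightarrow> nat) set"
  obtain C where C: "C \<ge> 0" and coeffs: "\<And>(d :: ('d \<Rightarrow> nat) \<Rightarrow> real) m \<beta>.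
    (\<forall>\<nu>\<in>ref_nodes k r. \<bar>\<Sum>\<beta>\<in>?J. d \<beta> * newton_prod r \<beta> \<nu>\<bar> \<le> m) \<Longrightarrow> \<beta> \<in> ?J \<Longrightarrow> \<bar>d \<beta>\<bar> \<le> C * m"
    using newton_coeffs_bounded_by_nodal_values[OF r, where 'd='d and k=k] by blast
  obtain B N' where B: "\<And>\<beta> :: 'd \<Rightarrow> nat. B \<beta> \<ge> 0" "\<And>\<beta> x. x \<in> ref_cell k \<Longrightarrow> \<bar>newton_prod r \<beta> x\<bar> \<le> B \<beta>"
    "\<And>\<beta> x. x \<in> ref_cell k \<Longrightarrow> (newton_prod r \<beta> has_derivative N' \<beta> x) (at x)"
    "\<And>\<beta> x w. x \<in> ref_cell k \<Longrightarrow> \<bar>N' \<beta> x w\<bar> \<le> B \<beta> * norm w"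
  proof -
    have "\<forall>\<beta> :: 'd \<Rightarrow> nat. \<exists>B f'. B \<ge> 0 \<and> (\<forall>x\<in>ref_cell k. \<bar>newton_prod r \<beta> x\<bar> \<le> B \<and>
        (newton_prod r \<beta> has_derivative f' x) (at x) \<and> (\<forall>w. \<bar>f' x w\<bar> \<le> B * norm w))"
      using C1_bounded_on_newton_prod[of k r, where 'd='d] unfolding C1_bounded_on_def by blast
    then obtain B N' where "\<forall>\<beta> :: 'd \<Rightarrow> nat. B \<beta> \<ge> 0 \<and> (\<forall>x\<in>ref_cell k. \<bar>newton_prod r \<beta> x\<bar> \<le> B \<beta> \<and>
        (newton_prod r \<beta> has_derivative N' \<beta> x) (at x) \<and> (\<forall>w. \<bar>N' \<beta> x w\<bar> \<le> B \<beta> * norm w))"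
      by (metis (no_types, lifting))
    with that show ?thesis
      by blast
  qed
  define K where "K = 1 + C * (\<Sum>\<beta>\<in>?J. B \<beta>)"
  have lin_comb: "\<bar>\<Sum>\<beta>\<in>?J. d \<beta> * z \<beta>\<bar> \<le> K * m * s"
    if d: "\<And>\<beta>. \<beta> \<in> ?J \<Longrightarrow> \<bar>d \<beta>\<bar> \<le> C * m" and z: "\<And>\<beta>. \<bar>z \<beta>\<bar> \<le> B \<beta> * s" and m: "m \<ge> 0" and s: "s \<ge> 0"
    for d z m s
  proof -
    have "\<bar>\<Sum>\<beta>\<in>?J. d \<beta> * z \<beta>\<bar> \<le> (\<Sum>\<beta>\<in>?J. \<bar>d \<beta> * z \<beta>\<bar>)"
      by (rule sum_abs)
    also have "\<dots> \<le> (\<Sum>\<beta>\<in>?J. (C * m) * (B \<beta> * s))"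
      unfolding abs_mult using d z C m by (intro sum_mono mult_mono) auto
    also have "\<dots> = (C * (\<Sum>\<beta>\<in>?J. B \<beta>)) * m * s"
      by (simp add: sum_distrib_left sum_distrib_right mult_ac)
    also have "\<dots> \<le> K * m * s"
      using m s by (intro mult_right_mono) (auto simp: K_def)
    finally show ?thesis .
  qed
  have zero_node: "\<exists>\<nu>. \<nu> \<in> (ref_nodes k r :: (real ^ 'd) set)"
    by (intro exI[of _ 0], cases k) (auto simp: ref_nodes_def intro!: exI[of _ 0])
  have "nodally_bounded k r K p"
    if p: "p \<in> ref_polys k r" for p :: "real ^ 'd \<Rightarrow> real"
  proof -
    obtain d where d: "\<And>x. p x = (\<Sum>\<beta>\<in>?J. d \<beta> * newton_prod r \<beta> x)"
      using ref_polys_newton_expansion[OF r p] by blast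
    have pd: "p = (\<lambda>x. \<Sum>\<beta>\<in>?J. d \<beta> * newton_prod r \<beta> x)"
      using d by blast
    have "\<bar>p \<xi>\<bar> \<le> K * m \<and> (p has_derivative (\<lambda>w. \<Sum>\<beta>\<in>?J. d \<beta> * N' \<beta> \<xi> w)) (at \<xi>) \<and>
      (\<forall>w. \<bar>\<Sum>\<beta>\<in>?J. d \<beta> * N' \<beta> \<xi> w\<bar> \<le> K * m * norm w)"
      if m: "\<forall>\<nu>\<in>ref_nodes k r. \<bar>p \<nu>\<bar> \<le> m" and \<xi>: "\<xi> \<in> ref_cell k" for m \<xi>
    proof (intro conjI allI)
      have m0: "m \<ge> 0"
        using m zero_node by (meson abs_ge_zero order_trans)
      have dC: "\<bar>d \<beta>\<bar> \<le> C * m" if "\<beta> \<in> ?J" for \<beta>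
        using m that unfolding d by (rule coeffs)
      show "\<bar>p \<xi>\<bar> \<le> K * m"
        using lin_comb[OF dC, where z="\<lambda>\<beta>. newton_prod r \<beta> \<xi>" and s=1] B(2)[OF \<xi>] m0 by (simp add: d)
      show "(p has_derivative (\<lambda>w. \<Sum>\<beta>\<in>?J. d \<beta> * N' \<beta> \<xi> w)) (at \<xi>)"
        unfolding pd by (intro has_derivative_sum has_derivative_mult_right B(3)[OF \<xi>])
      show "\<bar>\<Sum>\<beta>\<in>?J. d \<beta> * N' \<beta> \<xi> w\<bar> \<le> K * m * norm w" for w
        using lin_comb[OF dC, where z="\<lambda>\<beta>. N' \<beta> \<xi> w" and s="norm w"] B(4)[OF \<xi>] m0 by simp
    qed
    then show ?thesis
      unfolding nodally_bounded_def by (intro exI[of _ "\<lambda>\<xi> w. \<Sum>\<beta>\<in>?J. d \<beta> * N' \<beta> \<xi> w"]) blast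
  qed
  moreover have "K \<ge> 1"
    unfolding K_def using C B(1) by (simp add: sum_nonneg)
  ultimately show ?thesis
    by blast
qed


section \<open>Expanding injective maps\<close>

lemma expanding_linear_right_inverse:
  fixes A :: "'a::euclidean_space \<Rightarrow> 'a"
  assumes "linear A" "m > 0" "\<And>v. m * norm v \<le> norm (A v)"
  obtains B where "linear B" "A \<circ> B = id" "\<And>w. norm (B w) \<le> norm w / m"
proof -
  have "inj A"
    unfolding linear_injective_0[OF \<open>linear A\<close>]
  proof (intro allI impI)
    fix v assume "A v = 0"
    with assms(3)[of v] have "m * norm v \<le> 0"
      by simp
    with \<open>m > 0\<close> show "v = 0"
      by (simp add: mult_le_0_iff)
  qed
  then obtain B where B: "linear B" "\<And>w. A (B w) = w"
    using linear_injective_isomorphism[OF \<open>linear A\<close>] by metis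
  show thesis
  proof
    show "norm (B w) \<le> norm w / m" for w
      using assms(3)[of "B w"] \<open>m > 0\<close> by (simp add: B field_simps)
  qed (use B in auto)
qed

lemma inverse_of_expanding_has_derivative:
  fixes G :: "'a::euclidean_space \<Rightarrow> 'a"
  assumes U: "open U" "\<xi> \<in> U" and cont: "continuous_on U G" and inj: "inj_on G U"
    and G': "(G has_derivative G') (at \<xi>)" and m: "m > 0" "\<And>v. m * norm v \<le> norm (G' v)"
  obtains H' where "(inv_into U G has_derivative H') (at (G \<xi>))" "\<And>w. norm (H' w) \<le> norm w / m"
proof -
  obtain H' where H': "linear H'" "G' \<circ> H' = id" "\<And>w. norm (H' w) \<le> norm w / m"
    using expanding_linear_right_inverse[OF has_derivative_linear[OF G'] m] by blast
  have "(inv_into U G has_derivative H') (at (G \<xi>))"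
    by (rule has_derivative_inverse_strong[OF U cont _ G' H'(2)]) (use inj in auto)
  with H' that show thesis
    by blast
qed

text \<open>If the image missed a point of the ball of radius $m\<rho>$, take a missing point $z$ at the smallest
  distance $R < m\<rho>$ from the centre. On the ball of radius $R$ the inverse map is defined, and it is Lipschitz with
  constant $1/m$ because the ball is convex. So its values lie in the closed ball of radius
  $R/m < \<rho>$, whose image is compact and thus contains the sphere of radius $R$, including $z$.\<close>

lemma ball_subset_image_ball:
  fixes G :: "'a::euclidean_space \<Rightarrow> 'a"
  assumes inj: "inj_on G (ball \<xi> \<rho>)" and m: "m > 0"
    and deriv: "\<And>\<eta>. \<eta> \<in> ball \<xi> \<rho> \<Longrightarrow> (G has_derivative G' \<eta>) (at \<eta>)"
    and expand: "\<And>\<eta> v. \<eta> \<in> ball \<xi> \<rho> \<Longrightarrow> m * norm v \<le> norm (G' \<eta> v)"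
  shows "ball (G \<xi>) (m * \<rho>) \<subseteq> G ` ball \<xi> \<rho>"
proof (rule ccontr)
  assume "\<not> ?thesis"
  then obtain y where "y \<in> ball (G \<xi>) (m * \<rho>)" and y2: "y \<notin> G ` ball \<xi> \<rho>"
    by blast
  then have y: "dist (G \<xi>) y < m * \<rho>" "y \<notin> G ` ball \<xi> \<rho>"
    by simp_all
  have "0 < m * \<rho>"
    using y(1) zero_le_dist[of "G \<xi>" y] by linarith
  then have \<rho>: "\<rho> > 0"
    using m by (simp add: zero_less_mult_iff)
  let ?B = "ball \<xi> \<rho>"
  define H where "H = inv_into ?B G"
  have cont: "continuous_on ?B G"
    using deriv by (meson continuous_at_imp_continuous_on has_derivative_continuous)
  have op: "open (G ` ?B)"
    by (rule invariance_of_domain[OF cont open_ball inj])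
  obtain z where z: "z \<notin> G ` ?B" "\<And>w. w \<notin> G ` ?B \<Longrightarrow> dist (G \<xi>) z \<le> dist (G \<xi>) w"
    using distance_attains_inf[of "- (G ` ?B)" "G \<xi>"] op y(2) by (metis Compl_iff closed_Compl empty_iff)
  define R where "R = dist (G \<xi>) z"
  have R: "R < m * \<rho>"
    using z(2)[OF y(2)] y(1) by (simp add: R_def)
  have "G \<xi> \<in> G ` ?B"
    using \<rho> by simp
  with z(1) have "R > 0"
    by (auto simp: R_def)
  have sub: "ball (G \<xi>) R \<subseteq> G ` ?B"
    using z(2) by (force simp: R_def)
  have "\<exists>H'. (H has_derivative H') (at x) \<and> onorm H' \<le> 1 / m" if x: "x \<in> ball (G \<xi>) R" for x
  proof -
    obtain \<eta> where \<eta>: "\<eta> \<in> ?B" "x = G \<eta>"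
      using sub x by blast
    obtain H' where "(H has_derivative H') (at x)" "\<And>w. norm (H' w) \<le> norm w / m"
      using inverse_of_expanding_has_derivative[OF open_ball \<eta>(1) cont inj deriv[OF \<eta>(1)] m(1) expand[OF \<eta>(1)]]
      unfolding H_def \<eta>(2) by blast
    then show ?thesis
      by (intro exI[of _ H'] conjI onorm_bound) (use m(1) in \<open>auto simp: field_simps\<close>)
  qed
  then obtain H' where H': "\<And>x. x \<in> ball (G \<xi>) R \<Longrightarrow> (H has_derivative H' x) (at x)"
    "\<And>x. x \<in> ball (G \<xi>) R \<Longrightarrow> onorm (H' x) \<le> 1 / m"
    by metis
  have "ball (G \<xi>) R \<subseteq> G ` cball \<xi> (R / m)"
  proof
    fix x assume x: "x \<in> ball (G \<xi>) R"
    have "norm (H x - H (G \<xi>)) \<le> 1 / m * norm (x - G \<xi>)"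
      by (rule differentiable_bound[of "ball (G \<xi>) R" H H'])
        (use H' x \<open>R > 0\<close> in \<open>auto intro: has_derivative_at_withinI\<close>)
    also have "H (G \<xi>) = \<xi>"
      unfolding H_def using inj \<rho> by simp
    also have "1 / m * norm (x - G \<xi>) \<le> 1 / m * R"
      using x m(1) by (intro mult_left_mono) (auto simp: dist_norm norm_minus_commute)
    finally have "H x \<in> cball \<xi> (R / m)"
      by (simp add: dist_norm norm_minus_commute)
    moreover have "G (H x) = x"
      unfolding H_def using sub x by (intro f_inv_into_f) auto
    ultimately show "x \<in> G ` cball \<xi> (R / m)"
      by (metis imageI)
  qed
  moreover have small: "cball \<xi> (R / m) \<subseteq> ?B"
    using R m by (intro cball_subset_ball_iff[THEN iffD2]) (simp add: pos_divide_less_eq mult.commute)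
  then have "compact (G ` cball \<xi> (R / m))"
    using continuous_on_subset[OF cont] by (intro compact_continuous_image compact_cball)
  ultimately have "closure (ball (G \<xi>) R) \<subseteq> G ` cball \<xi> (R / m)"
    by (intro closure_minimal compact_imp_closed)
  moreover have "z \<in> closure (ball (G \<xi>) R)"
    using \<open>R > 0\<close> by (simp add: R_def)
  ultimately show False
    using z(1) small by blast
qed


text \<open>The gradient $g$ of $v = p \<circ> G^{-1}$ satisfies $|g|^2 = Dp (DG^{-1} g) \<le> B |g| / m$.\<close>

lemma norm_grad_of_pullback_le:
  fixes G :: "real ^ 'd \<Rightarrow> real ^ 'd"
  assumes U: "open U" "\<xi> \<in> U" and cont: "continuous_on U G" and inj: "inj_on G U"
    and G': "(G has_derivative G') (at \<xi>)" and m: "m > 0" "\<And>v. m * norm v \<le> norm (G' v)"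
    and p': "(p has_derivative p') (at \<xi>)" and B: "B \<ge> 0" "\<And>w. \<bar>p' w\<bar> \<le> B * norm w"
    and pull: "\<And>\<eta>. \<eta> \<in> U \<Longrightarrow> v (G \<eta>) = p \<eta>"
  shows "norm (grad v (G \<xi>)) \<le> B / m"
proof -
  obtain H' where H': "(inv_into U G has_derivative H') (at (G \<xi>))" "\<And>w. norm (H' w) \<le> norm w / m"
    using inverse_of_expanding_has_derivative[OF U cont inj G' m] by blast
  define L where "L = p' \<circ> H'"
  have "inv_into U G (G \<xi>) = \<xi>"
    using inj U(2) by simp
  then have "(p \<circ> inv_into U G has_derivative L) (at (G \<xi>))"
    unfolding L_def using H'(1) p' by (intro diff_chain_at) auto
  then have deriv: "(v has_derivative L) (at (G \<xi>))"
  proof (rule has_derivative_transform_within_open)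
    show "open (G ` U)"
      by (rule invariance_of_domain[OF cont U(1) inj])
    show "(p \<circ> inv_into U G) x = v x" if "x \<in> G ` U" for x
      using that inj pull by auto
  qed (use U in auto)
  define g where "g = (\<Sum>b\<in>Basis. L b *\<^sub>R b)"
  have "linear L"
    using deriv by (rule has_derivative_linear)
  have L_eq: "L h = inner h g" for h
  proof -
    have "L h = L (\<Sum>b\<in>Basis. inner h b *\<^sub>R b)"
      by (simp add: euclidean_representation)
    also have "\<dots> = (\<Sum>b\<in>Basis. inner h b * L b)"
      using \<open>linear L\<close> by (simp add: linear_sum linear_cmul)
    also have "\<dots> = inner h g"
      by (simp add: g_def inner_sum_right mult.commute)
    finally show ?thesis .
  qed
  have "(v has_derivative (\<lambda>h. inner h g)) (at (G \<xi>))"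
    using deriv L_eq by (metis ext)
  then have gd: "gderiv v (G \<xi>) g"
    by (simp add: gderiv_def)
  have "g' = g" if "gderiv v (G \<xi>) g'" for g'
  proof -
    have "(\<lambda>h. inner h g') = (\<lambda>h. inner h g)"
      using that gd unfolding gderiv_def by (rule has_derivative_unique)
    then show ?thesis
      by (metis vector_eq_ldot)
  qed
  with gd have "grad v (G \<xi>) = g"
    unfolding grad_def by (rule the_equality)
  moreover have "norm g * norm g \<le> (B / m) * norm g"
  proof -
    have "norm g * norm g = L g"
      by (simp add: L_eq dot_square_norm power2_eq_square)
    also have "\<dots> \<le> \<bar>p' (H' g)\<bar>"
      by (simp add: L_def)
    also have "\<dots> \<le> B * norm (H' g)"
      by (rule B(2))
    also have "\<dots> \<le> B * (norm g / m)"
      using B(1) H'(2) by (intro mult_left_mono)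
    finally show ?thesis
      by simp
  qed
  then have "norm g \<le> B / m"
    using B(1) m(1) by (cases "g = 0") (auto dest: mult_right_le_imp_le simp del: times_divide_eq_left)
  ultimately show ?thesis
    by simp
qed

section \<open>Geometry of quasi-uniform meshes\<close>

lemma unit_ball_measure_pos: "measure lebesgue (ball (0 :: 'a::euclidean_space) 1) > 0"
  using content_ball_pos[of 1 "0 :: 'a"] by (simp add: measure_completion)

lemma measure_ball_scale:
  fixes x :: "'a::euclidean_space"
  assumes "s \<ge> 0"
  shows "measure lebesgue (ball x s) = s ^ DIM('a) * measure lebesgue (ball (0 :: 'a) 1)"
  using content_ball_conv_unit_ball[OF assms, of x] by (simp add: measure_completion)

lemma measure_cball_scale:
  fixes x :: "'a::euclidean_space"
  assumes "s \<ge> 0"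
  shows "measure lebesgue (cball x s) = s ^ DIM('a) * measure lebesgue (ball (0 :: 'a) 1)"
  using content_cball_conv_ball[of x s] measure_ball_scale[OF assms, of x] by (simp add: measure_completion)

lemma ref_polys_differentiable:
  assumes "p \<in> ref_polys k r"
  shows "p differentiable (at (x :: real ^ 'd))"
proof -
  obtain c where p: "p = (\<lambda>x. \<Sum>\<alpha>\<in>multi_indices k r. c \<alpha> * (\<Prod>i\<in>UNIV. (x $ i) ^ \<alpha> i))"
    using assms unfolding ref_polys_def by blast
  have "(\<lambda>x :: real ^ 'd. (x $ i) ^ n) differentiable (at x)" for i n
    by (intro differentiable_power bounded_linear_imp_differentiable bounded_linear_vec_nth)
  then have "((\<lambda>x :: real ^ 'd. (x $ i) ^ n) has_derivative frechet_derivative (\<lambda>x. (x $ i) ^ n) (at x)) (at x)"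
    for i n
    by (simp add: frechet_derivative_works)
  then have "(\<lambda>x :: real ^ 'd. \<Prod>i\<in>UNIV. (x $ i) ^ \<alpha> i) differentiable (at x)" for \<alpha>
    unfolding differentiable_def by (intro exI) (rule has_derivative_prod)
  then show ?thesis
    unfolding p by (intro differentiable_sum differentiable_mult ballI) (auto simp: finite_multi_indices)
qed

text \<open>If $\<delta> = 1/(2d)$ is the radius of the ball in the reference cell, then each cell contains a ball of radius
  $\<delta>h/(\<kappa>q)$, and the cells near a point lie in a ball of radius $2h$. The bound is the ratio of the two volumes.\<close>

definition overlap_bound :: "nat \<Rightarrow> real \<Rightarrow> real \<Rightarrow> real" where
  "overlap_bound d \<kappa> q = (4 * real d * \<kappa> * q) ^ d"

locale conforming =
  fixes k :: cell_kind and D :: "(real ^ 'd) set" and M :: "'d mesh"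
  assumes mesh: "conforming_mesh k D M"
    and nonempty: "D \<noteq> {}"
begin

abbreviation h :: real where "h \<equiv> mesh_width k M"

lemma finite_cells: "finite M"
  using mesh by (simp add: conforming_mesh_def)

lemma cells_nonempty: "M \<noteq> {}"
  using mesh nonempty closure_subset[of D] by (auto simp: conforming_mesh_def)

lemma cells_cover: "(\<Union>G\<in>M. G ` ref_cell k) = closure D"
  using mesh by (simp add: conforming_mesh_def)

lemma inj_on_cell: "G \<in> M \<Longrightarrow> inj_on G (ref_cell k)"
  using mesh by (simp add: conforming_mesh_def)

lemma inj_on_interior: "G \<in> M \<Longrightarrow> inj_on G (interior (ref_cell k))"
  using inj_on_cell inj_on_subset interior_subset by blast

lemma cell_has_derivative:
  assumes "G \<in> M"
  shows "(G has_derivative frechet_derivative G (at x)) (at x)"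
proof -
  have "(\<lambda>x. G x $ i) differentiable (at x)" for i
    using mesh assms by (intro ref_polys_differentiable[of _ k 1]) (simp add: conforming_mesh_def)
  then have "((\<lambda>x. G x $ i) has_derivative frechet_derivative (\<lambda>x. G x $ i) (at x)) (at x)" for i
    by (simp add: frechet_derivative_works)
  then have "((\<lambda>x. \<chi> i. G x $ i) has_derivative (\<lambda>w. \<chi> i. frechet_derivative (\<lambda>x. G x $ i) (at x) w)) (at x)"
    by (subst has_derivative_componentwise_within) (auto simp: Basis_vec_def inner_axis)
  then have "G differentiable (at x)"
    by (auto simp: differentiable_def)
  then show ?thesis
    by (simp add: frechet_derivative_works)
qed

lemma continuous_on_cell: "G \<in> M \<Longrightarrow> continuous_on S G"
  by (meson cell_has_derivative continuous_at_imp_continuous_on has_derivative_continuous)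

lemma compact_cell: "G \<in> M \<Longrightarrow> compact (G ` ref_cell k)"
  by (intro compact_continuous_image continuous_on_cell compact_ref_cell)

lemma dist_cell_le_diameter:
  "G \<in> M \<Longrightarrow> x \<in> G ` ref_cell k \<Longrightarrow> y \<in> G ` ref_cell k \<Longrightarrow> dist x y \<le> diameter (G ` ref_cell k)"
  using compact_cell compact_imp_bounded diameter_bounded_bound by blast

lemma diameter_le_mesh_width: "G \<in> M \<Longrightarrow> diameter (G ` ref_cell k) \<le> h"
  unfolding mesh_width_def using finite_cells by (intro Max_ge) auto

lemma dist_cell_le: "G \<in> M \<Longrightarrow> x \<in> G ` ref_cell k \<Longrightarrow> y \<in> G ` ref_cell k \<Longrightarrow> dist x y \<le> h"
  using dist_cell_le_diameter diameter_le_mesh_width order_trans by blast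

lemma diameter_pos:
  assumes "G \<in> M"
  shows "diameter (G ` ref_cell k) > 0"
proof -
  obtain a where a: "a \<in> interior (ref_cell k :: (real ^ 'd) set)"
    using interior_ref_cell_nonempty by blast
  then obtain b where b: "b \<in> interior (ref_cell k)" "b \<noteq> a"
    using not_open_singleton[of a] open_interior[of "ref_cell k :: (real ^ 'd) set"]
    by (metis insertI1 insert_absorb insert_not_empty is_singletonI is_singletonI' is_singleton_def)
  then have "G a \<noteq> G b"
    using inj_on_interior[OF assms] a by (metis inj_onD)
  moreover have "dist (G a) (G b) \<le> diameter (G ` ref_cell k)"
    using a b interior_subset by (intro dist_cell_le_diameter[OF assms]) blast+
  ultimately show ?thesis
    by (metis dist_pos_lt less_le_trans)
qed

lemma mesh_width_pos: "h > 0"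
  using cells_nonempty diameter_pos diameter_le_mesh_width by (metis all_not_in_conv less_le_trans)

lemma open_image_interior: "G \<in> M \<Longrightarrow> open (G ` interior (ref_cell k))"
  by (intro invariance_of_domain continuous_on_cell inj_on_interior) auto

text \<open>Two cells meet in the image of a proper face, and a proper face of the reference cell misses its
  interior.\<close>

lemma interior_cell_disjoint_cell:
  assumes "F \<in> M" "G \<in> M" "F \<noteq> G"
  shows "F ` interior (ref_cell k) \<inter> G ` ref_cell k = {}"
proof (rule ccontr)
  assume "\<not> ?thesis"
  then obtain \<xi> where \<xi>: "\<xi> \<in> interior (ref_cell k)" "F \<xi> \<in> G ` ref_cell k"
    by blast
  obtain A where A: "A face_of ref_cell k" "A \<noteq> ref_cell k" "F ` ref_cell k \<inter> G ` ref_cell k = F ` A"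
  proof -
    have "\<forall>F\<in>M. \<forall>G\<in>M. F \<noteq> G \<longrightarrow>
        (\<exists>A B. A face_of ref_cell k \<and> A \<noteq> ref_cell k \<and> B face_of ref_cell k \<and> B \<noteq> ref_cell k \<and>
               F ` ref_cell k \<inter> G ` ref_cell k = F ` A \<and> F ` ref_cell k \<inter> G ` ref_cell k = G ` B)"
      using mesh unfolding conforming_mesh_def by (elim conjE)
    from this[rule_format, OF assms] that show ?thesis
      by (elim exE conjE)
  qed
  have "\<xi> \<in> ref_cell k"
    using \<xi>(1) interior_subset by blast
  moreover have "F \<xi> \<in> F ` A"
    using A(3) \<xi> \<open>\<xi> \<in> ref_cell k\<close> by blast
  ultimately have "\<xi> \<in> A"
    using inj_on_cell[OF assms(1)] face_of_imp_subset[OF A(1)] by (meson inj_on_image_mem_iff)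
  with \<xi>(1) face_of_disjoint_interior[OF A(1,2)] show False
    by blast
qed

end

locale regular_mesh = conforming k D M
  for k :: cell_kind and D :: "(real ^ 'd) set" and M :: "'d mesh" +
  fixes \<kappa> q :: real
  assumes regular: "shape_regular k \<kappa> M"
    and uniform: "quasi_uniform k q M"
begin

lemma mesh_width_le: "G \<in> M \<Longrightarrow> h \<le> q * diameter (G ` ref_cell k)"
  using uniform by (simp add: quasi_uniform_def)

lemma quasi_uniformity_ge_1: "q \<ge> 1"
proof -
  obtain G where G: "G \<in> M"
    using cells_nonempty by blast
  have d: "diameter (G ` ref_cell k) > 0" "diameter (G ` ref_cell k) \<le> q * diameter (G ` ref_cell k)"
    using mesh_width_le[OF G] diameter_le_mesh_width[OF G] diameter_pos[OF G] by linarith+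
  then show ?thesis
    by simp
qed

lemma regularity_pos: "\<kappa> > 0"
proof -
  obtain G where G: "G \<in> M"
    using cells_nonempty by blast
  obtain a where a: "a \<in> (ref_cell k :: (real ^ 'd) set)"
    using interior_ref_cell_nonempty interior_subset by blast
  obtain v :: "real ^ 'd" where v: "norm v = 1"
    using vector_choose_size[of 1] by auto
  have "0 < diameter (G ` ref_cell k) * norm v"
    using diameter_pos[OF G] v by simp
  also have "\<dots> \<le> \<kappa> * norm (frechet_derivative G (at a) v)"
    using regular G a by (auto simp: shape_regular_def)
  finally show ?thesis
    by (simp add: zero_less_mult_iff)
qed

text \<open>Shape regularity bounds the derivative from below in terms of the diameter of the cell, and
  quasi-uniformity replaces that diameter by $h$.\<close>

lemma cell_expands:
  assumes "G \<in> M" "\<xi> \<in> ref_cell k"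
  shows "h / (\<kappa> * q) * norm v \<le> norm (frechet_derivative G (at \<xi>) v)"
proof -
  have "h * norm v \<le> q * diameter (G ` ref_cell k) * norm v"
    using mesh_width_le[OF assms(1)] by (rule mult_right_mono) simp
  also have "\<dots> \<le> q * (\<kappa> * norm (frechet_derivative G (at \<xi>) v))"
    using regular assms quasi_uniformity_ge_1 unfolding shape_regular_def mult.assoc
    by (intro mult_left_mono) auto
  finally show ?thesis
    using regularity_pos quasi_uniformity_ge_1 by (simp add: field_simps)
qed

lemma expansion_pos: "h / (\<kappa> * q) > 0"
  using mesh_width_pos regularity_pos quasi_uniformity_ge_1 by simp

lemma ball_subset_cell:
  assumes "G \<in> M" "ball \<xi> \<rho> \<subseteq> ref_cell k"
  shows "ball (G \<xi>) (h / (\<kappa> * q) * \<rho>) \<subseteq> G ` ball \<xi> \<rho>"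
  by (rule ball_subset_image_ball[OF _ expansion_pos cell_has_derivative])
    (use assms inj_on_subset[OF inj_on_cell] cell_expands in auto)

lemma overlap_nonneg: "overlap_bound CARD('d) \<kappa> q \<ge> 0"
  unfolding overlap_bound_def using regularity_pos quasi_uniformity_ge_1 by simp

text \<open>Volume comparison: the cells that meet the ball of radius $h$ lie in the ball of radius $2h$, and each contains a ball
  of radius comparable to $h$ in its interior; these balls are disjoint.\<close>

lemma card_cells_near_le_overlap:
  "real (card {G \<in> M. G ` ref_cell k \<inter> cball x h \<noteq> {}}) \<le> overlap_bound CARD('d) \<kappa> q"
proof -
  let ?\<delta> = "1 / (2 * real CARD('d))"
  let ?z = "(\<chi> i. ?\<delta>) :: real ^ 'd"
  let ?A = "{G \<in> M. G ` ref_cell k \<inter> cball x h \<noteq> {}}"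
  let ?s = "h / (\<kappa> * q) * ?\<delta>"
  let ?V = "measure lebesgue (ball (0 :: real ^ 'd) 1)"
  have s: "?s > 0"
    by (rule mult_pos_pos[OF expansion_pos]) simp
  have ball_in: "ball (G ?z) ?s \<subseteq> G ` interior (ref_cell k)" if "G \<in> M" for G
  proof -
    have "ball ?z ?\<delta> \<subseteq> interior (ref_cell k)"
      by (rule interior_maximal[OF ball_subset_ref_cell open_ball])
    then show ?thesis
      using ball_subset_cell[OF that ball_subset_ref_cell] by blast
  qed
  have cell_in: "G ` ref_cell k \<subseteq> cball x (2 * h)" if G: "G \<in> ?A" for G
  proof
    fix y assume y: "y \<in> G ` ref_cell k"
    have "G ` ref_cell k \<inter> cball x h \<noteq> {}"
      using G by simp
    then obtain z where z: "z \<in> G ` ref_cell k" "z \<in> cball x h"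
      by blast
    have "dist z y \<le> h"
      using dist_cell_le z(1) y G by blast
    then show "y \<in> cball x (2 * h)"
      using z(2) dist_triangle[of x y z] by (simp add: dist_commute)
  qed
  have "(\<Sum>G\<in>?A. measure lebesgue (ball (G ?z) ?s)) = measure lebesgue (\<Union>G\<in>?A. ball (G ?z) ?s)"
  proof (rule measure_negligible_finite_Union_image[symmetric])
    show "pairwise (\<lambda>F G. negligible (ball (F ?z) ?s \<inter> ball (G ?z) ?s)) ?A"
    proof (rule pairwiseI)
      fix F G assume FG: "F \<in> ?A" "G \<in> ?A" "F \<noteq> G"
      then have "ball (F ?z) ?s \<inter> ball (G ?z) ?s = {}"
        using interior_cell_disjoint_cell[of F G] ball_in[of F] ball_in[of G] interior_subset by blast
      then show "negligible (ball (F ?z) ?s \<inter> ball (G ?z) ?s)"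
        by simp
    qed
  qed (auto simp: finite_cells)
  also have "\<dots> \<le> measure lebesgue (cball x (2 * h))"
  proof (rule measure_mono_fmeasurable)
    show "(\<Union>G\<in>?A. ball (G ?z) ?s) \<subseteq> cball x (2 * h)"
      using ball_in cell_in interior_subset by blast
    show "(\<Union>G\<in>?A. ball (G ?z) ?s) \<in> sets lebesgue"
      by (intro sets.finite_UN fmeasurableD lmeasurable_ball) (simp add: finite_cells)
  qed simp
  also have "\<dots> = (2 * h) ^ CARD('d) * ?V"
    using mesh_width_pos by (subst measure_cball_scale) auto
  also have "(\<Sum>G\<in>?A. measure lebesgue (ball (G ?z) ?s)) = real (card ?A) * (?s ^ CARD('d) * ?V)"
    using s by (simp only: sum_constant measure_ball_scale[OF less_imp_le[OF s]] DIM_cart DIM_real mult_1_right)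
  finally have "real (card ?A) * (?s ^ CARD('d) * ?V) \<le> (2 * h) ^ CARD('d) * ?V" .
  moreover have "?V > 0"
    by (rule unit_ball_measure_pos)
  ultimately have "real (card ?A) * ?s ^ CARD('d) \<le> (2 * h) ^ CARD('d)"
    by (simp add: mult.assoc[symmetric])
  also have "(2 * h) ^ CARD('d) = overlap_bound CARD('d) \<kappa> q * ?s ^ CARD('d)"
  proof -
    have "2 * h = 4 * real CARD('d) * \<kappa> * q * ?s"
      using regularity_pos quasi_uniformity_ge_1 by (simp add: field_simps)
    then show ?thesis
      unfolding overlap_bound_def by (simp only: power_mult_distrib)
  qed
  finally show ?thesis
    using s by (meson mult_le_cancel_right_pos zero_less_power)
qed

lemma card_cells_at_le_overlap: "real (card {G \<in> M. x \<in> G ` ref_cell k}) \<le> overlap_bound CARD('d) \<kappa> q"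
proof -
  have "card {G \<in> M. x \<in> G ` ref_cell k} \<le> card {G \<in> M. G ` ref_cell k \<inter> cball x h \<noteq> {}}"
    using finite_cells mesh_width_pos by (intro card_mono) auto
  then show ?thesis
    using card_cells_near_le_overlap[of x] by linarith
qed

end


section \<open>Refinement\<close>

lemma ref_cell_Simplicial: "(ref_cell Simplicial :: (real ^ 'd) set) = convex hull (insert 0 (range (\<lambda>i. axis i 1)))"
proof -
  have B: "(Basis :: (real ^ 'd) set) = range (\<lambda>i. axis i 1)"
    by (auto simp: Basis_vec_def)
  have "(\<Sum>b\<in>Basis. x \<bullet> b) = (\<Sum>i\<in>UNIV. x $ i)" for x :: "real ^ 'd"
    by (subst B, subst sum.reindex) (auto simp: inj_on_def axis_eq_axis inner_axis)
  moreover have "(\<forall>b\<in>Basis. 0 \<le> x \<bullet> b) \<longleftrightarrow> (\<forall>i. 0 \<le> x $ i)" for x :: "real ^ 'd"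
    unfolding B by (auto simp: inner_axis)
  ultimately have "convex hull (insert 0 Basis) = (ref_cell Simplicial :: (real ^ 'd) set)"
    unfolding std_simplex by simp
  then show ?thesis
    unfolding B by simp
qed

text \<open>For simplices, a child is the affine image of the convex hull of the vertices, and its
  vertices are midpoints of two vertices of the parent. The counting of steps only shows that the
  two indices stay in the range of the ordering.\<close>

lemma subdivision_maps_into_ref_cell:
  fixes s :: "real ^ 'd \<Rightarrow> real ^ 'd"
  assumes "S \<in> subdivisions k" "s \<in> S"
  shows "s ` ref_cell k \<subseteq> ref_cell k"
proof (cases k)
  case Tensor
  then obtain b where s: "s = (\<lambda>x. (1/2) *\<^sub>R (x + b))" and b: "\<And>i. b $ i = 0 \<or> b $ i = 1"
    using assms by auto
  have "0 \<le> s x $ i \<and> s x $ i \<le> 1" if "\<And>i. 0 \<le> x $ i \<and> x $ i \<le> 1" for x i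
    using that[of i] b[of i] unfolding s by auto
  then show ?thesis
    using Tensor by auto
next
  case Simplicial
  let ?n = "CARD('d)"
  obtain v where v: "bij_betw v {..?n} (insert 0 (range (\<lambda>i. axis i 1)) :: (real ^ 'd) set)"
    and lin: "linear (\<lambda>x. s x - s 0)"
    and vert: "\<exists>S \<subseteq> {..<?n}. \<forall>j\<le>?n.
             s (v j) = (1/2) *\<^sub>R (v (card (S \<inter> {..<j})) + v (card S + card ({..<j} - S)))"
    using assms Simplicial by auto
  then obtain S where S: "S \<subseteq> {..<?n}" and s: "\<And>j. j \<le> ?n \<Longrightarrow>
             s (v j) = (1/2) *\<^sub>R (v (card (S \<inter> {..<j})) + v (card S + card ({..<j} - S)))"
    by blast
  let ?V = "insert 0 (range (\<lambda>i. axis i 1)) :: (real ^ 'd) set"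
  have V: "?V = v ` {..?n}"
    using v by (simp add: bij_betw_def)
  have ref: "ref_cell k = convex hull ?V"
    unfolding Simplicial by (rule ref_cell_Simplicial)
  have v_in: "v j \<in> ref_cell k" if "j \<le> ?n" for j
    using that V hull_inc[of "v j" ?V convex] unfolding ref by auto
  have vert_in: "s (v j) \<in> ref_cell k" if j: "j \<le> ?n" for j
  proof -
    have "card (S \<inter> {..<j}) \<le> card {..<?n}"
      using S by (intro card_mono) auto
    moreover have "card S + card ({..<j} - S) = card (S \<union> ({..<j} - S))"
      using S finite_subset[OF S] by (intro card_Un_disjoint[symmetric]) auto
    moreover have "card (S \<union> ({..<j} - S)) \<le> card {..<?n}"
      using S j by (intro card_mono) auto
    ultimately have "v (card (S \<inter> {..<j})) \<in> ref_cell k" "v (card S + card ({..<j} - S)) \<in> ref_cell k"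
      using v_in by auto
    then have "(1/2) *\<^sub>R v (card (S \<inter> {..<j})) + (1/2) *\<^sub>R v (card S + card ({..<j} - S)) \<in> ref_cell k"
      by (intro convexD[OF convex_ref_cell]) auto
    then show ?thesis
      using s[OF j] by (simp add: scaleR_add_right)
  qed
  have "s ` ref_cell k = (+) (s 0) ` (\<lambda>x. s x - s 0) ` (convex hull ?V)"
    unfolding ref image_image by simp
  also have "\<dots> = convex hull ((+) (s 0) ` (\<lambda>x. s x - s 0) ` ?V)"
    by (simp only: convex_hull_linear_image[OF lin, symmetric] convex_hull_translation)
  also have "(+) (s 0) ` (\<lambda>x. s x - s 0) ` ?V = s ` ?V"
    unfolding image_image by simp
  also have "convex hull (s ` ?V) \<subseteq> ref_cell k"
  proof (rule hull_minimal)
    show "s ` ?V \<subseteq> ref_cell k"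
      unfolding V using vert_in by auto
  qed (rule convex_ref_cell)
  finally show ?thesis .
qed

lemma uniform_refinement_cell_subset:
  fixes M :: "'d::finite mesh"
  assumes "uniform_refinement k M M'" "G \<in> M'"
  shows "\<exists>F\<in>M. G ` ref_cell k \<subseteq> F ` ref_cell k"
proof -
  obtain C where C: "\<forall>F\<in>M. C F \<in> subdivisions k" "M' = (\<Union>F\<in>M. (\<lambda>s. F \<circ> s) ` C F)"
    using assms(1) unfolding uniform_refinement_def by blast
  obtain F s where F: "F \<in> M" "s \<in> C F" "G = F \<circ> s"
    using assms(2) C(2) by auto
  have "s ` ref_cell k \<subseteq> ref_cell k"
    using subdivision_maps_into_ref_cell C(1) F(1,2) by blast
  then have "G ` ref_cell k \<subseteq> F ` ref_cell k"
    using F(3) by (auto simp: image_comp[symmetric])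
  then show ?thesis
    using F(1) by blast
qed

lemma mesh_hierarchy_cell_subset:
  fixes M :: "nat \<Rightarrow> 'd::finite mesh"
  assumes hier: "mesh_hierarchy k D \<kappa> n M" and "l \<le> j" "j \<le> n" "G \<in> M j"
  shows "\<exists>F\<in>M l. G ` ref_cell k \<subseteq> F ` ref_cell k"
  using assms(2-)
proof (induction j arbitrary: G rule: dec_induct)
  case base
  then show ?case
    by blast
next
  case (step j)
  have "uniform_refinement k (M j) (M (Suc j))"
    using hier step.prems by (simp add: mesh_hierarchy_def)
  from uniform_refinement_cell_subset[OF this step.prems(2)]
  obtain F where F: "F \<in> M j" "G ` ref_cell k \<subseteq> F ` ref_cell k"
    by blast
  then obtain E where "E \<in> M l" "F ` ref_cell k \<subseteq> E ` ref_cell k"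
    using step.IH[of F] step.prems by auto
  with F show ?case
    by blast
qed

lemma mesh_hierarchy_conforming:
  assumes "mesh_hierarchy k D \<kappa> n M" "j \<le> n" "D \<noteq> {}"
  shows "conforming k D (M j)"
  using assms by unfold_locales (simp_all add: mesh_hierarchy_def)

lemma mesh_hierarchy_width_antimono:
  fixes M :: "nat \<Rightarrow> 'd::finite mesh"
  assumes hier: "mesh_hierarchy k D \<kappa> n M" and "l \<le> n" "D \<noteq> {}"
  shows "mesh_width k (M n) \<le> mesh_width k (M l)"
proof -
  interpret fine: conforming k D "M n"
    using mesh_hierarchy_conforming[OF hier] assms(3) by simp
  interpret coarse: conforming k D "M l"
    using mesh_hierarchy_conforming[OF hier] assms by simp
  have "diameter (G ` ref_cell k) \<le> mesh_width k (M l)" if G: "G \<in> M n" for G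
  proof -
    obtain F where F: "F \<in> M l" "G ` ref_cell k \<subseteq> F ` ref_cell k"
      using mesh_hierarchy_cell_subset[OF hier assms(2) order_refl G] by blast
    have "diameter (G ` ref_cell k) \<le> diameter (F ` ref_cell k)"
      using F coarse.compact_cell by (intro diameter_subset) (auto intro: compact_imp_bounded)
    also have "\<dots> \<le> mesh_width k (M l)"
      using coarse.diameter_le_mesh_width F(1) by blast
    finally show ?thesis .
  qed
  then show ?thesis
    unfolding mesh_width_def[of k "M n"] using fine.finite_cells fine.cells_nonempty by simp
qed

text \<open>The tiles cover the closure of $P$, so that nodes on the boundary of $P$ are points of tiles, while
  their interiors lie in $P$, so that integrals over them are parts of an integral over $P$.\<close>

definition tiles :: "cell_kind \<Rightarrow> 'd::finite mesh \<Rightarrow> (real ^ 'd) set \<Rightarrow> bool" where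
  "tiles k T P \<longleftrightarrow> open P \<and> closure P = (\<Union>G\<in>T. G ` ref_cell k) \<and> (\<forall>G\<in>T. G ` interior (ref_cell k) \<subseteq> P)"

lemma (in conforming) cell_subset_closure_interior:
  assumes "F \<in> M"
  shows "F ` ref_cell k \<subseteq> closure (F ` interior (ref_cell k))"
proof -
  have "F ` closure (interior (ref_cell k)) \<subseteq> closure (F ` interior (ref_cell k))"
    by (intro image_closure_subset continuous_on_cell[OF assms] closed_closure closure_subset)
  then show ?thesis
    by (simp add: closure_interior_ref_cell)
qed

text \<open>The interior of a coarse cell $F$ of the patch is covered by fine cells, since these cover the whole domain.
  A fine cell that meets it lies in some coarse cell, which must be $F$ as no other coarse cell meets the interior of
  $F$. Taking closures, the fine cells inside the cells of the patch cover it.\<close>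

lemma patch_tiled_by_finer_cells:
  fixes M :: "nat \<Rightarrow> 'd::finite mesh"
  assumes hier: "mesh_hierarchy k D \<kappa> n M" and j: "j \<le> n" and D: "D \<noteq> {}" and patch: "is_patch k a (M 0) P"
  shows "\<exists>T\<subseteq>M j. tiles k T P"
proof -
  interpret coarse: conforming k D "M 0"
    using mesh_hierarchy_conforming[OF hier] D by simp
  interpret fine: conforming k D "M j"
    using mesh_hierarchy_conforming[OF hier j] D by simp
  obtain C where C: "C \<subseteq> M 0" and P: "P = interior (\<Union>F\<in>C. F ` ref_cell k)"
    using patch unfolding is_patch_def by blast
  let ?K = "\<Union>F\<in>C. F ` ref_cell k"
  have "finite C"
    using C coarse.finite_cells finite_subset by blast
  then have "closed ?K"
    using C coarse.compact_cell by (intro closed_UN ballI compact_imp_closed) auto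
  have coarse_int: "F ` interior (ref_cell k) \<subseteq> P" if "F \<in> C" for F
    unfolding P using that C coarse.open_image_interior interior_subset[of "ref_cell k :: (real ^ 'd) set"]
    by (intro interior_maximal) blast+
  have closure_P: "closure P = ?K"
  proof
    show "closure P \<subseteq> ?K"
      unfolding P using \<open>closed ?K\<close> by (intro closure_minimal interior_subset)
    show "?K \<subseteq> closure P"
      using coarse.cell_subset_closure_interior C closure_mono[OF coarse_int] by blast
  qed
  define T where "T = {G \<in> M j. \<exists>F\<in>C. G ` ref_cell k \<subseteq> F ` ref_cell k}"
  let ?K' = "\<Union>G\<in>T. G ` ref_cell k"
  have "finite T"
    unfolding T_def using fine.finite_cells by simp
  then have "closed ?K'"
    using fine.compact_cell by (intro closed_UN ballI compact_imp_closed) (auto simp: T_def)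
  have "F ` interior (ref_cell k) \<subseteq> ?K'" if F: "F \<in> C" for F
  proof
    fix x assume x: "x \<in> F ` interior (ref_cell k)"
    have "F ` ref_cell k \<subseteq> closure D"
      using coarse.cells_cover F C by blast
    then have "x \<in> closure D"
      using x interior_subset[of "ref_cell k :: (real ^ 'd) set"] by blast
    then obtain G where G: "G \<in> M j" "x \<in> G ` ref_cell k"
      using fine.cells_cover by blast
    obtain F' where F': "F' \<in> M 0" "G ` ref_cell k \<subseteq> F' ` ref_cell k"
      using mesh_hierarchy_cell_subset[OF hier le0 j G(1)] by blast
    have "F' = F"
      using coarse.interior_cell_disjoint_cell[of F F'] F C F' x G(2) by blast
    then show "x \<in> ?K'"
      using F F' G unfolding T_def by blast
  qed
  then have "closure (F ` interior (ref_cell k)) \<subseteq> ?K'" if "F \<in> C" for F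
    using that \<open>closed ?K'\<close> by (intro closure_minimal) auto
  then have KK': "?K \<subseteq> ?K'"
    using coarse.cell_subset_closure_interior C by blast
  have K'K: "?K' \<subseteq> ?K"
    unfolding T_def by blast
  have tiled: "closure P = ?K'"
    unfolding closure_P by (rule subset_antisym[OF KK' K'K])
  have interiors: "G ` interior (ref_cell k) \<subseteq> P" if "G \<in> T" for G
  proof -
    have "G ` interior (ref_cell k) \<subseteq> ?K"
      by (rule order_trans[OF image_mono[OF interior_subset] order_trans[OF UN_upper[OF that] K'K]])
    then show ?thesis
      unfolding P using that fine.open_image_interior by (intro interior_maximal) (auto simp: T_def)
  qed
  have "tiles k T P"
    unfolding tiles_def tiled using interiors by (intro conjI ballI refl) (simp add: P)
  moreover have "T \<subseteq> M j"
    unfolding T_def by blast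
  ultimately show ?thesis
    by blast
qed


section \<open>Discrete and continuous norms on a patch\<close>

lemma set_integrable_continuous_closure:
  fixes e :: "'a::euclidean_space \<Rightarrow> real"
  assumes "bounded S" "continuous_on (closure S) e" "A \<in> sets lebesgue" "A \<subseteq> closure S"
  shows "set_integrable lebesgue A e"
proof -
  have "compact (closure S)"
    using assms(1) by simp
  then have int: "integrable lborel (\<lambda>x. indicator (closure S) x *\<^sub>R e x)"
    using assms(2) by (rule borel_integrable_compact)
  then have "set_integrable lebesgue (closure S) e"
    unfolding set_integrable_def using integrable_completion[OF borel_measurable_integrable[OF int]] by blast
  then show ?thesis
    using assms(3,4) by (rule set_integrable_subset)
qed

lemma integrable_indicator_scaleR:
  fixes c :: real
  assumes "S \<in> lmeasurable"
  shows "integrable lebesgue (\<lambda>x. indicator S x *\<^sub>R c)"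
  using assms unfolding lmeasurable_iff_integrable by (rule integrable_scaleR_left)

lemma set_integral_norm_square_nonneg: "0 \<le> (LINT x:S|lebesgue. (norm (g x))\<^sup>2)"
  unfolding set_lebesgue_integral_def by (rule Bochner_Integration.integral_nonneg) simp

lemma L2_norm_square: "(L2_norm S g)\<^sup>2 = (LINT x:S|lebesgue. (norm (g x))\<^sup>2)"
  unfolding L2_norm_def by (rule real_sqrt_pow2[OF set_integral_norm_square_nonneg])

lemma L2_norm_nonneg: "L2_norm S g \<ge> 0"
  unfolding L2_norm_def by (rule real_sqrt_ge_zero[OF set_integral_norm_square_nonneg])

lemma norm_le_card_times_bound:
  fixes x :: "real ^ 'd"
  assumes "\<And>i. \<bar>x $ i\<bar> \<le> b"
  shows "norm x \<le> real CARD('d) * b"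
proof -
  have "norm x \<le> (\<Sum>i\<in>UNIV. \<bar>x $ i\<bar>)"
    by (rule norm_le_l1_cart)
  also have "\<dots> \<le> (\<Sum>i\<in>(UNIV::'d set). b)"
    using assms by (intro sum_mono)
  finally show ?thesis
    by simp
qed

text \<open>In units of $h$, the radius of a ball in a cell on which a polynomial keeps half of its maximum.\<close>

definition sampling_radius :: "nat \<Rightarrow> real \<Rightarrow> real \<Rightarrow> real \<Rightarrow> real" where
  "sampling_radius d \<kappa> q C = 1 / (4 * real d * (1 + real d) * \<kappa> * q * C)"

locale patch_mesh = regular_mesh k D M \<kappa> q
  for k :: cell_kind and D :: "(real ^ 'd) set" and M :: "'d mesh" and \<kappa> q :: real +
  fixes r :: nat and C :: real and P :: "(real ^ 'd) set" and T :: "'d mesh"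
  assumes degree: "r \<ge> 1"
    and open_domain: "open D"
    and C_ge_1: "C \<ge> 1"
    and nodal_stability: "\<And>p :: real ^ 'd \<Rightarrow> real. p \<in> ref_polys k r \<Longrightarrow> nodally_bounded k r C p"
    and T_subset: "T \<subseteq> M"
    and tiles: "tiles k T P"
begin

lemma nodal_stabilityE:
  fixes p :: "real ^ 'd \<Rightarrow> real"
  assumes "p \<in> ref_polys k r" "\<And>\<nu>. \<nu> \<in> ref_nodes k r \<Longrightarrow> \<bar>p \<nu>\<bar> \<le> m"
  obtains p' where "\<And>\<xi>. \<xi> \<in> ref_cell k \<Longrightarrow> \<bar>p \<xi>\<bar> \<le> C * m"
    "\<And>\<xi>. \<xi> \<in> ref_cell k \<Longrightarrow> (p has_derivative p' \<xi>) (at \<xi>)"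
    "\<And>\<xi> w. \<xi> \<in> ref_cell k \<Longrightarrow> \<bar>p' \<xi> w\<bar> \<le> C * m * norm w"
proof -
  obtain p' where p': "\<forall>m. (\<forall>\<nu>\<in>ref_nodes k r. \<bar>p \<nu>\<bar> \<le> m) \<longrightarrow>
      (\<forall>\<xi>\<in>ref_cell k. \<bar>p \<xi>\<bar> \<le> C * m \<and> (p has_derivative p' \<xi>) (at \<xi>) \<and> (\<forall>w. \<bar>p' \<xi> w\<bar> \<le> C * m * norm w))"
    using nodal_stability[OF assms(1)] unfolding nodally_bounded_def by (rule exE)
  have "\<forall>\<xi>\<in>ref_cell k. \<bar>p \<xi>\<bar> \<le> C * m \<and> (p has_derivative p' \<xi>) (at \<xi>) \<and> (\<forall>w. \<bar>p' \<xi> w\<bar> \<le> C * m * norm w)"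
    by (rule p'[THEN spec, THEN mp]) (use assms(2) in simp)
  then show thesis
    by (intro that[of p']) simp_all
qed

lemma open_patch: "open P"
  using tiles by (simp add: tiles_def)

lemma closure_patch: "closure P = (\<Union>G\<in>T. G ` ref_cell k)"
  using tiles by (simp add: tiles_def)

lemma interior_tile: "G \<in> T \<Longrightarrow> G ` interior (ref_cell k) \<subseteq> P"
  using tiles by (simp add: tiles_def)

lemma tile_subset: "G \<in> T \<Longrightarrow> G ` ref_cell k \<subseteq> closure P"
  unfolding closure_patch by (rule UN_upper)

lemma finite_tiles: "finite T"
  using T_subset finite_cells finite_subset by blast

lemma closure_patch_subset: "closure P \<subseteq> closure D"
  unfolding closure_patch cells_cover[symmetric] using T_subset by (intro UN_mono) auto

lemma bounded_patch: "bounded P"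
proof -
  have "compact (closure P)"
    unfolding closure_patch using T_subset compact_cell by (intro compact_UN finite_tiles) auto
  then show ?thesis
    by (rule bounded_subset[OF compact_imp_bounded closure_subset])
qed

definition piecewise_poly :: "(real ^ 'd \<Rightarrow> real) \<Rightarrow> bool" where
  "piecewise_poly e \<longleftrightarrow> (\<forall>G\<in>T. \<exists>p\<in>ref_polys k r. \<forall>\<xi>\<in>ref_cell k. e (G \<xi>) = p \<xi>)"

abbreviation nodes :: "(real ^ 'd) set" where
  "nodes \<equiv> patch_nodes k r D M P"

lemma finite_ref_nodes: "finite (ref_nodes k r :: (real ^ 'd) set)"
  unfolding ref_nodes_eq_lattice[OF degree] by (intro finite_imageI finite_multi_indices)

lemma finite_nodes: "finite nodes"
  unfolding patch_nodes_def using finite_cells finite_ref_nodes by simp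

lemma ref_nodes_subset: "ref_nodes k r \<subseteq> (ref_cell k :: (real ^ 'd) set)"
  by (auto simp: ref_nodes_def)

lemma sampling_radius_pos: "sampling_radius CARD('d) \<kappa> q C > 0"
  unfolding sampling_radius_def using regularity_pos quasi_uniformity_ge_1 C_ge_1
  by (intro divide_pos_pos mult_pos_pos) (simp_all add: add_pos_nonneg)

text \<open>The pull-back $p$ attains the maximum $s$ of its modulus at a point $\<xi>0$ of the reference cell. Its
  derivative is at most $C s$, so $|p| \<ge> s/2$ on a small ball near $\<xi>0$, which is moved into the cell by
  contracting the standard ball towards $\<xi>0$. The image of this ball contains a ball of radius comparable to $h$.
  The point $x$ of the cell is arbitrary, so that the nodes of neighbouring cells are included.\<close>

lemma cell_value_le_integral:
  assumes G: "G \<in> T" and e: "piecewise_poly e" "continuous_on (closure P) e" and x: "x \<in> G ` ref_cell k"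
  shows "(e x)\<^sup>2 * ((sampling_radius CARD('d) \<kappa> q C * h) ^ CARD('d) * measure lebesgue (ball (0 :: real ^ 'd) 1))
    \<le> 4 * (LINT y:(G ` interior (ref_cell k))|lebesgue. (e y)\<^sup>2)"
proof -
  let ?d = "real CARD('d)"
  let ?\<delta> = "1 / (2 * ?d)"
  let ?z = "(\<chi> i. ?\<delta>) :: real ^ 'd"
  let ?A = "G ` interior (ref_cell k)"
  let ?R = "ref_cell k :: (real ^ 'd) set"
  have GM: "G \<in> M"
    using G T_subset by blast
  obtain p where p: "p \<in> ref_polys k r" "\<And>\<xi>. \<xi> \<in> ?R \<Longrightarrow> e (G \<xi>) = p \<xi>"
    using e(1) G unfolding piecewise_poly_def by blast
  have "continuous_on ?R (\<lambda>\<xi>. \<bar>p \<xi>\<bar>)"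
    using ref_polys_differentiable[OF p(1)]
    by (intro continuous_intros continuous_at_imp_continuous_on ballI) (simp add: differentiable_imp_continuous_within)
  then obtain \<xi>0 where \<xi>0: "\<xi>0 \<in> ?R" "\<And>\<xi>. \<xi> \<in> ?R \<Longrightarrow> \<bar>p \<xi>\<bar> \<le> \<bar>p \<xi>0\<bar>"
    using continuous_attains_sup[OF compact_ref_cell ref_cell_nonempty] by blast
  define s where "s = \<bar>p \<xi>0\<bar>"
  obtain p' where p': "\<And>\<xi>. \<xi> \<in> ?R \<Longrightarrow> (p has_derivative p' \<xi>) (at \<xi>)"
    "\<And>\<xi> w. \<xi> \<in> ?R \<Longrightarrow> \<bar>p' \<xi> w\<bar> \<le> C * s * norm w"
  proof (rule nodal_stabilityE[OF p(1)])
    show "\<bar>p \<nu>\<bar> \<le> s" if "\<nu> \<in> ref_nodes k r" for \<nu>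
      unfolding s_def using subsetD[OF ref_nodes_subset that] by (rule \<xi>0(2))
  qed (rule that)
  have Cs: "0 \<le> C * s"
    using C_ge_1 by (simp add: s_def)
  have lip: "\<bar>p \<xi> - p \<xi>0\<bar> \<le> C * s * norm (\<xi> - \<xi>0)" if "\<xi> \<in> ?R" for \<xi>
  proof -
    have "norm (p \<xi> - p \<xi>0) \<le> C * s * norm (\<xi> - \<xi>0)"
    proof (rule differentiable_bound[OF convex_ref_cell])
      show "onorm (p' \<eta>) \<le> C * s" if "\<eta> \<in> ?R" for \<eta>
        using p'(2)[OF that] Cs by (intro onorm_bound) auto
    qed (use that \<xi>0(1) p'(1) in \<open>auto intro: has_derivative_at_withinI\<close>)
    then show ?thesis
      by simp
  qed
  \<comment> \<open>With this contraction factor every point of the ball has distance at most $1/(2C)$ from $\<xi>0$.\<close>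
  define t where "t = 1 / (2 * C * (1 + ?d))"
  have d1: "?d \<ge> 1"
    by (simp add: Suc_leI)
  have \<delta>_le_1: "?\<delta> \<le> 1"
    using d1 divide_le_eq_1_pos[of "2 * ?d" 1] by linarith
  have C0: "2 * C * (1 + ?d) > 0"
    using C_ge_1 d1 by simp
  have "1 * 1 \<le> (2 * C) * (1 + ?d)"
    using C_ge_1 by (intro mult_mono) auto
  then have t: "0 < t" "t \<le> 1"
    unfolding t_def using C0 by simp_all
  define \<xi>1 where "\<xi>1 = (1 - t) *\<^sub>R \<xi>0 + t *\<^sub>R ?z"
  have in_ref: "ball \<xi>1 (t * ?\<delta>) \<subseteq> ?R"
  proof
    fix \<xi> assume \<xi>: "\<xi> \<in> ball \<xi>1 (t * ?\<delta>)"
    define \<zeta> where "\<zeta> = ?z + (1 / t) *\<^sub>R (\<xi> - \<xi>1)"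
    have "dist ?z \<zeta> = norm (\<xi> - \<xi>1) / t"
      using t by (simp add: \<zeta>_def dist_norm)
    also have "\<dots> < ?\<delta>"
      using \<xi> t by (simp add: dist_norm norm_minus_commute pos_divide_less_eq mult.commute)
    finally have "\<zeta> \<in> ball ?z ?\<delta>"
      by simp
    then have "\<zeta> \<in> ?R"
      using ball_subset_ref_cell by blast
    then have "(1 - t) *\<^sub>R \<xi>0 + t *\<^sub>R \<zeta> \<in> ?R"
      using \<xi>0(1) t by (intro convexD[OF convex_ref_cell]) auto
    moreover have "(1 - t) *\<^sub>R \<xi>0 + t *\<^sub>R \<zeta> = \<xi>"
      using t by (simp add: \<zeta>_def \<xi>1_def scaleR_add_right)
    ultimately show "\<xi> \<in> ?R"
      by simp
  qed
  have close: "\<bar>p \<xi>\<bar> \<ge> s / 2" if \<xi>: "\<xi> \<in> ball \<xi>1 (t * ?\<delta>)" for \<xi>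
  proof -
    have "norm (?z - \<xi>0) \<le> ?d * 1"
    proof (rule norm_le_card_times_bound)
      show "\<bar>(?z - \<xi>0) $ i\<bar> \<le> 1" for i
      proof -
        have "0 \<le> \<xi>0 $ i" "\<xi>0 $ i \<le> 1" 
          using \<xi>0(1) ref_cell_le_1[OF \<xi>0(1), of i] by (cases k; simp)+
        moreover have "0 \<le> ?\<delta>"
          by simp
        moreover note \<delta>_le_1
        ultimately show ?thesis
          unfolding vector_minus_component vec_lambda_beta by linarith
      qed
    qed
    moreover have "\<xi>1 - \<xi>0 = t *\<^sub>R (?z - \<xi>0)"
      by (simp add: \<xi>1_def algebra_simps)
    then have "norm (\<xi>1 - \<xi>0) = t * norm (?z - \<xi>0)"
      using t by simp
    ultimately have "norm (\<xi>1 - \<xi>0) \<le> t * ?d"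
      using t by simp
    moreover have "norm (\<xi> - \<xi>1) \<le> t * 1"
    proof -
      have "norm (\<xi> - \<xi>1) \<le> t * ?\<delta>"
        using \<xi> by (simp add: dist_norm norm_minus_commute)
      also have "\<dots> \<le> t * 1"
        using t \<delta>_le_1 by (intro mult_left_mono) auto
      finally show ?thesis .
    qed
    ultimately have "norm (\<xi> - \<xi>0) \<le> t * (1 + ?d)"
      using norm_triangle_ineq[of "\<xi> - \<xi>1" "\<xi>1 - \<xi>0"] by (simp add: distrib_left)
    then have "C * s * norm (\<xi> - \<xi>0) \<le> C * s * (t * (1 + ?d))"
      using Cs by (rule mult_left_mono)
    also have "\<dots> = s / 2"
      unfolding t_def using C_ge_1 d1 C0 by (simp add: field_simps)
    finally have "\<bar>p \<xi> - p \<xi>0\<bar> \<le> s / 2"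
      using lip[of \<xi>] in_ref \<xi> by fastforce
    then show ?thesis
      unfolding s_def by linarith
  qed
  let ?B = "ball (G \<xi>1) (sampling_radius CARD('d) \<kappa> q C * h)"
  have radius: "sampling_radius CARD('d) \<kappa> q C * h = h / (\<kappa> * q) * (t * ?\<delta>)"
    unfolding sampling_radius_def t_def by simp
  have B_sub: "?B \<subseteq> G ` ball \<xi>1 (t * ?\<delta>)"
    using ball_subset_cell[OF GM in_ref] by (simp only: radius)
  moreover have "ball \<xi>1 (t * ?\<delta>) \<subseteq> interior ?R"
    by (rule interior_maximal[OF in_ref open_ball])
  ultimately have B_sub_A: "?B \<subseteq> ?A"
    by blast
  have on_B: "(s / 2)\<^sup>2 \<le> (e y)\<^sup>2" if y: "y \<in> ?B" for y
  proof -
    obtain \<xi> where \<xi>: "\<xi> \<in> ball \<xi>1 (t * ?\<delta>)" "y = G \<xi>"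
      using B_sub y by blast
    then have "s / 2 \<le> \<bar>e y\<bar>"
      using close[OF \<xi>(1)] p(2)[of \<xi>] in_ref by auto
    then show ?thesis
      by (intro abs_le_square_iff[THEN iffD1]) (simp add: s_def)
  qed
  have int_A: "set_integrable lebesgue ?A (\<lambda>y. (e y)\<^sup>2)"
  proof (rule set_integrable_continuous_closure[OF bounded_patch])
    show "?A \<in> sets lebesgue"
      using open_image_interior[OF GM] by simp
    show "?A \<subseteq> closure P"
      using interior_tile[OF G] closure_subset by blast
  qed (intro continuous_intros e)
  have "(s / 2)\<^sup>2 * measure lebesgue ?B = (LINT y:?B|lebesgue. (s / 2)\<^sup>2)"
    by (simp add: set_lebesgue_integral_def mult.commute)
  also have "\<dots> \<le> (LINT y:?A|lebesgue. (e y)\<^sup>2)"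
    unfolding set_lebesgue_integral_def
  proof (rule integral_mono)
    show "integrable lebesgue (\<lambda>y. indicator ?B y *\<^sub>R (s / 2)\<^sup>2)"
      by (rule integrable_indicator_scaleR[OF lmeasurable_ball])
    show "integrable lebesgue (\<lambda>y. indicator ?A y *\<^sub>R (e y)\<^sup>2)"
      using int_A by (simp add: set_integrable_def)
    show "indicator ?B y *\<^sub>R (s / 2)\<^sup>2 \<le> indicator ?A y *\<^sub>R (e y)\<^sup>2" for y
      using on_B[of y] B_sub_A by (auto simp: indicator_def)
  qed
  finally have "s\<^sup>2 * measure lebesgue ?B \<le> 4 * (LINT y:?A|lebesgue. (e y)\<^sup>2)"
    by (simp add: power_divide)
  moreover have "(e x)\<^sup>2 \<le> s\<^sup>2"
  proof -
    obtain \<xi> where "\<xi> \<in> ?R" "x = G \<xi>"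
      using x by blast
    then have "\<bar>e x\<bar> \<le> s"
      using \<xi>0(2)[of \<xi>] p(2)[of \<xi>] by (simp add: s_def)
    then show ?thesis
      by (intro abs_le_square_iff[THEN iffD1]) simp
  qed
  then have "(e x)\<^sup>2 * measure lebesgue ?B \<le> s\<^sup>2 * measure lebesgue ?B"
    by (intro mult_right_mono) auto
  moreover have "measure lebesgue ?B = (sampling_radius CARD('d) \<kappa> q C * h) ^ CARD('d) * measure lebesgue (ball (0 :: real ^ 'd) 1)"
    using sampling_radius_pos mesh_width_pos by (subst measure_ball_scale) auto
  ultimately show ?thesis
    by simp
qed

lemma sum_cell_integrals_le:
  assumes e: "continuous_on (closure P) e"
  shows "(\<Sum>G\<in>T. LINT y:(G ` interior (ref_cell k))|lebesgue. (e y)\<^sup>2) \<le> (L2_norm P e)\<^sup>2"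
proof -
  let ?A = "\<lambda>G. G ` interior (ref_cell k)"
  have int: "set_integrable lebesgue A (\<lambda>y. (e y)\<^sup>2)" if A: "open A" "A \<subseteq> P" for A
  proof (rule set_integrable_continuous_closure[OF bounded_patch])
    show "continuous_on (closure P) (\<lambda>y. (e y)\<^sup>2)"
      by (intro continuous_intros e)
    show "A \<in> sets lebesgue"
      using A(1) by simp
    show "A \<subseteq> closure P"
      using A(2) closure_subset by (rule order_trans)
  qed
  have intA: "set_integrable lebesgue (?A G) (\<lambda>y. (e y)\<^sup>2)" if "G \<in> T" for G
    using open_image_interior subsetD[OF T_subset that] interior_tile[OF that] by (intro int)
  have disj: "disjoint_family_on ?A T"
    unfolding disjoint_family_on_def
  proof (intro ballI impI)
    fix F G assume "F \<in> T" "G \<in> T" "F \<noteq> G"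
    then have "?A F \<inter> G ` ref_cell k = {}"
      using T_subset by (intro interior_cell_disjoint_cell) auto
    then show "?A F \<inter> ?A G = {}"
      using interior_subset[of "ref_cell k :: (real ^ 'd) set"] by blast
  qed
  have "(\<Sum>G\<in>T. LINT y:?A G|lebesgue. (e y)\<^sup>2) = (LINT y|lebesgue. (\<Sum>G\<in>T. indicator (?A G) y *\<^sub>R (e y)\<^sup>2))"
    unfolding set_lebesgue_integral_def
    by (rule Bochner_Integration.integral_sum[symmetric]) (use intA in \<open>simp add: set_integrable_def\<close>)
  also have "\<dots> \<le> (LINT y|lebesgue. indicator P y *\<^sub>R (e y)\<^sup>2)"
  proof (rule integral_mono)
    show "integrable lebesgue (\<lambda>y. \<Sum>G\<in>T. indicator (?A G) y *\<^sub>R (e y)\<^sup>2)"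
      using intA by (intro Bochner_Integration.integrable_sum) (simp add: set_integrable_def)
    show "integrable lebesgue (\<lambda>y. indicator P y *\<^sub>R (e y)\<^sup>2)"
      using int[OF open_patch] by (simp add: set_integrable_def)
    show "(\<Sum>G\<in>T. indicator (?A G) y *\<^sub>R (e y)\<^sup>2) \<le> indicator P y *\<^sub>R (e y)\<^sup>2" for y
    proof -
      have "(\<Sum>G\<in>T. indicator (?A G) y :: real) = indicator (\<Union>G\<in>T. ?A G) y"
        by (rule indicator_UN_disjoint[OF finite_tiles disj, symmetric])
      also have "\<dots> \<le> indicator P y"
        using interior_tile by (auto simp: indicator_def)
      finally have "(\<Sum>G\<in>T. indicator (?A G) y) * (e y)\<^sup>2 \<le> indicator P y * (e y)\<^sup>2"
        by (rule mult_right_mono) simp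
      then show ?thesis
        by (simp add: sum_distrib_right)
    qed
  qed
  finally show ?thesis
    unfolding L2_norm_square by (simp add: set_lebesgue_integral_def)
qed

text \<open>A node in the cell belongs to a cell that touches it, and there is a bounded number of such cells.
  In this way the count is independent of how the nodes of neighbouring cells match on a common
  face.\<close>

lemma card_nodes_in_cell_le:
  assumes "G \<in> M"
  shows "real (card (nodes \<inter> G ` ref_cell k)) \<le> overlap_bound CARD('d) \<kappa> q * real (card (ref_nodes k r :: (real ^ 'd) set))"
proof -
  let ?N = "ref_nodes k r :: (real ^ 'd) set"
  have "G ` ref_cell k \<noteq> {}"
    by (simp add: ref_cell_nonempty)
    then obtain x0 where x0: "x0 \<in> G ` ref_cell k"
      by blast
  let ?A = "{F \<in> M. F ` ref_cell k \<inter> cball x0 h \<noteq> {}}"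
  have fin: "finite ?A"
    using finite_cells by simp
  have "nodes \<inter> G ` ref_cell k \<subseteq> (\<Union>F\<in>?A. F ` ?N)"
  proof
    fix y assume y: "y \<in> nodes \<inter> G ` ref_cell k"
    then obtain F where F: "F \<in> M" "y \<in> F ` ?N"
      unfolding patch_nodes_def by blast
    have "dist x0 y \<le> h"
      using dist_cell_le[OF assms x0] y by blast
    moreover have "y \<in> F ` ref_cell k"
      using F(2) ref_nodes_subset by blast
    ultimately have "y \<in> F ` ref_cell k \<inter> cball x0 h"
      by simp
    then show "y \<in> (\<Union>F\<in>?A. F ` ?N)"
      using F by blast
  qed
  then have "card (nodes \<inter> G ` ref_cell k) \<le> card (\<Union>F\<in>?A. F ` ?N)"
    using fin finite_ref_nodes by (intro card_mono) auto
  also have "\<dots> \<le> (\<Sum>F\<in>?A. card (F ` ?N))"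
    using fin by (rule card_UN_le)
  also have "\<dots> \<le> (\<Sum>F\<in>?A. card ?N)"
    using finite_ref_nodes by (intro sum_mono card_image_le)
  finally have "card (nodes \<inter> G ` ref_cell k) \<le> card ?A * card ?N"
    by simp
  then have "real (card (nodes \<inter> G ` ref_cell k)) \<le> real (card ?A) * real (card ?N)"
    unfolding of_nat_mult[symmetric] by (rule of_nat_mono)
  also have "\<dots> \<le> overlap_bound CARD('d) \<kappa> q * real (card ?N)"
    using card_cells_near_le_overlap by (intro mult_right_mono) auto
  finally show ?thesis .
qed

text \<open>Charge each node to the tiles that contain it. A tile receives a bounded number of nodes, each
  costing at most a multiple of the integral over its interior, and the interiors are disjoint.\<close>

theorem nodal_sum_le_L2_norm:
  assumes e: "piecewise_poly e" "continuous_on (closure P) e"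
  shows "(\<Sum>x\<in>nodes. (e x)\<^sup>2) * ((sampling_radius CARD('d) \<kappa> q C * h) ^ CARD('d) * measure lebesgue (ball (0 :: real ^ 'd) 1))
    \<le> 4 * overlap_bound CARD('d) \<kappa> q * real (card (ref_nodes k r :: (real ^ 'd) set)) * (L2_norm P e)\<^sup>2"
proof -
  let ?m = "(sampling_radius CARD('d) \<kappa> q C * h) ^ CARD('d) * measure lebesgue (ball (0 :: real ^ 'd) 1)"
  let ?N = "overlap_bound CARD('d) \<kappa> q * real (card (ref_nodes k r :: (real ^ 'd) set))"
  let ?I = "\<lambda>G. LINT y:(G ` interior (ref_cell k))|lebesgue. (e y)\<^sup>2"
  have I_nonneg: "?I G \<ge> 0" for G
    by (auto simp: set_lebesgue_integral_def intro!: integral_nonneg_AE)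
  have m: "?m \<ge> 0"
    using sampling_radius_pos mesh_width_pos by simp
  have "(\<Sum>x\<in>nodes. (e x)\<^sup>2) \<le> (\<Sum>x\<in>nodes. \<Sum>G\<in>T. if x \<in> G ` ref_cell k then (e x)\<^sup>2 else 0)"
  proof (rule sum_mono)
    fix x assume "x \<in> nodes"
    then obtain G where G: "G \<in> T" "x \<in> G ` ref_cell k"
      unfolding patch_nodes_def closure_patch by blast
    then show "(e x)\<^sup>2 \<le> (\<Sum>G\<in>T. if x \<in> G ` ref_cell k then (e x)\<^sup>2 else 0)"
      using member_le_sum[of G T "\<lambda>G. if x \<in> G ` ref_cell k then (e x)\<^sup>2 else 0"] finite_tiles by simp
  qed
  also have "\<dots> = (\<Sum>G\<in>T. \<Sum>x\<in>nodes \<inter> G ` ref_cell k. (e x)\<^sup>2)"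
    by (subst sum.swap) (simp add: sum.inter_restrict[OF finite_nodes])
  finally have "(\<Sum>x\<in>nodes. (e x)\<^sup>2) * ?m \<le> (\<Sum>G\<in>T. \<Sum>x\<in>nodes \<inter> G ` ref_cell k. (e x)\<^sup>2) * ?m"
    using m by (rule mult_right_mono)
  also have "\<dots> = (\<Sum>G\<in>T. \<Sum>x\<in>nodes \<inter> G ` ref_cell k. (e x)\<^sup>2 * ?m)"
    by (simp only: sum_distrib_right)
  also have "\<dots> \<le> (\<Sum>G\<in>T. \<Sum>x\<in>nodes \<inter> G ` ref_cell k. 4 * ?I G)"
    by (intro sum_mono cell_value_le_integral e) auto
  also have "\<dots> = (\<Sum>G\<in>T. real (card (nodes \<inter> G ` ref_cell k)) * (4 * ?I G))"
    by (simp only: sum_constant)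
  also have "\<dots> \<le> (\<Sum>G\<in>T. ?N * (4 * ?I G))"
    using T_subset I_nonneg by (intro sum_mono mult_right_mono card_nodes_in_cell_le) auto
  also have "\<dots> = ?N * 4 * (\<Sum>G\<in>T. ?I G)"
    by (simp only: sum_distrib_left mult.assoc)
  also have "\<dots> \<le> ?N * 4 * (L2_norm P e)\<^sup>2"
    using overlap_nonneg by (intro mult_left_mono sum_cell_integrals_le e) auto
  finally show ?thesis
    by (simp add: mult_ac)
qed

text \<open>A Lagrange node of a tile either carries a degree of freedom or lies on the boundary of the domain,
  where the function vanishes.\<close>

lemma ref_node_value_le:
  assumes G: "G \<in> T" and zero: "\<And>x. x \<in> frontier D \<inter> closure P \<Longrightarrow> v x = 0" and \<nu>: "\<nu> \<in> ref_nodes k r"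
  shows "\<bar>v (G \<nu>)\<bar> \<le> sqrt (\<Sum>x\<in>nodes \<inter> G ` ref_cell k. (v x)\<^sup>2)"
proof -
  let ?S = "\<Sum>x\<in>nodes \<inter> G ` ref_cell k. (v x)\<^sup>2"
  have in_cell: "G \<nu> \<in> G ` ref_cell k"
    using \<nu> ref_nodes_subset by blast
  then have in_P: "G \<nu> \<in> closure P"
    using tile_subset[OF G] by blast
  have "(v (G \<nu>))\<^sup>2 \<le> ?S"
  proof (cases "G \<nu> \<in> D")
    case True
    then have "G \<nu> \<in> nodes \<inter> G ` ref_cell k"
      using in_cell in_P G T_subset \<nu> by (auto simp: patch_nodes_def)
    then show ?thesis
      using member_le_sum[of "G \<nu>" "nodes \<inter> G ` ref_cell k" "\<lambda>x. (v x)\<^sup>2"] finite_nodes by auto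
  next
    case False
    then have "G \<nu> \<in> frontier D"
      using in_P closure_patch_subset open_domain by (auto simp: frontier_def interior_open)
    then show ?thesis
      using zero in_P by (simp add: sum_nonneg)
  qed
  then have "sqrt ((v (G \<nu>))\<^sup>2) \<le> sqrt ?S"
    by (rule real_sqrt_le_mono)
  then show ?thesis
    by simp
qed

lemma norm_grad_on_tile_le:
  assumes G: "G \<in> T" and v: "piecewise_poly v" and zero: "\<And>x. x \<in> frontier D \<inter> closure P \<Longrightarrow> v x = 0"
    and \<xi>: "\<xi> \<in> interior (ref_cell k)"
  shows "(norm (grad v (G \<xi>)))\<^sup>2 \<le> (C * \<kappa> * q / h)\<^sup>2 * (\<Sum>x\<in>nodes \<inter> G ` ref_cell k. (v x)\<^sup>2)"
proof -
  let ?S = "\<Sum>x\<in>nodes \<inter> G ` ref_cell k. (v x)\<^sup>2"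
  have GM: "G \<in> M"
    using G T_subset by blast
  have \<xi>': "\<xi> \<in> ref_cell k"
    using \<xi> interior_subset by blast
  obtain p where p: "p \<in> ref_polys k r" "\<And>\<xi>. \<xi> \<in> ref_cell k \<Longrightarrow> v (G \<xi>) = p \<xi>"
    using v G unfolding piecewise_poly_def by blast
  obtain p' where p': "\<And>\<eta>. \<eta> \<in> ref_cell k \<Longrightarrow> (p has_derivative p' \<eta>) (at \<eta>)"
    "\<And>\<eta> w. \<eta> \<in> ref_cell k \<Longrightarrow> \<bar>p' \<eta> w\<bar> \<le> C * sqrt ?S * norm w"
  proof (rule nodal_stabilityE[OF p(1)])
    show "\<bar>p \<nu>\<bar> \<le> sqrt ?S" if "\<nu> \<in> ref_nodes k r" for \<nu>
    proof -
      have "\<bar>v (G \<nu>)\<bar> \<le> sqrt ?S"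
        using G zero that by (rule ref_node_value_le)
      then show ?thesis
        by (simp only: p(2)[OF subsetD[OF ref_nodes_subset that]])
    qed
  qed (rule that)
  have S: "?S \<ge> 0"
    by (simp add: sum_nonneg)
  have "norm (grad v (G \<xi>)) \<le> C * sqrt ?S / (h / (\<kappa> * q))"
  proof (rule norm_grad_of_pullback_le[OF open_interior \<xi> continuous_on_cell[OF GM] inj_on_interior[OF GM]
        cell_has_derivative[OF GM] expansion_pos cell_expands[OF GM \<xi>'] p'(1)[OF \<xi>'] _ p'(2)[OF \<xi>']])
    show "0 \<le> C * sqrt ?S"
      using C_ge_1 S by simp
    show "v (G \<eta>) = p \<eta>" if "\<eta> \<in> interior (ref_cell k)" for \<eta>
      using that p(2) interior_subset by blast
  qed
  also have "C * sqrt ?S / (h / (\<kappa> * q)) = C * \<kappa> * q / h * sqrt ?S"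
    by (simp add: field_simps)
  finally have "(norm (grad v (G \<xi>)))\<^sup>2 \<le> (C * \<kappa> * q / h * sqrt ?S)\<^sup>2"
    by (rule power_mono) simp
  then show ?thesis
    by (simp only: power_mult_distrib[of "C * \<kappa> * q / h"] real_sqrt_pow2[OF S])
qed

text \<open>The bound holds pointwise in the interiors of the tiles, hence almost everywhere in the patch. Its
  integral over a tile costs the factor $h^d$, and summing over the tiles counts each node at most as
  often as there are cells containing it.\<close>

theorem L2_norm_grad_le_nodal_sum:
  assumes v: "piecewise_poly v" and zero: "\<And>x. x \<in> frontier D \<inter> closure P \<Longrightarrow> v x = 0"
  shows "(L2_norm P (grad v))\<^sup>2
    \<le> overlap_bound CARD('d) \<kappa> q * measure lebesgue (ball (0 :: real ^ 'd) 1) * (C * \<kappa> * q / h)\<^sup>2 * h ^ CARD('d) * (\<Sum>x\<in>nodes. (v x)\<^sup>2)"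
proof -
  let ?S = "\<lambda>G. \<Sum>x\<in>nodes \<inter> G ` ref_cell k. (v x)\<^sup>2"
  let ?K = "(C * \<kappa> * q / h)\<^sup>2"
  let ?V = "measure lebesgue (ball (0 :: real ^ 'd) 1)"
  let ?f = "\<lambda>x. indicator P x *\<^sub>R (norm (grad v x))\<^sup>2"
  let ?g = "\<lambda>x. \<Sum>G\<in>T. indicator (G ` ref_cell k) x *\<^sub>R (?K * ?S G)"
  have S: "?S G \<ge> 0" for G
    by (simp add: sum_nonneg)
  have g_nonneg: "0 \<le> indicator (G ` ref_cell k) x *\<^sub>R (?K * ?S G)" for G x
    by (intro scaleR_nonneg_nonneg mult_nonneg_nonneg S) auto
  define Z where "Z = (\<Union>G\<in>T. G ` frontier (ref_cell k))"
  have "negligible Z"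
    unfolding Z_def
  proof (rule negligible_Union)
    show "finite ((\<lambda>G. G ` frontier (ref_cell k)) ` T)"
      using finite_tiles by simp
    fix N assume "N \<in> (\<lambda>G. G ` frontier (ref_cell k)) ` T"
    then obtain G where G: "G \<in> M" "N = G ` frontier (ref_cell k)"
      using T_subset by blast
    have "G differentiable_on frontier (ref_cell k)"
      using cell_has_derivative[OF G(1)] has_derivative_at_withinI
      unfolding differentiable_on_def differentiable_def by blast
    then show "negligible N"
      unfolding G(2)
      by (intro negligible_differentiable_image_negligible negligible_convex_frontier convex_ref_cell) auto
  qed
  then have null: "Z \<in> null_sets lebesgue"
    by (simp add: negligible_iff_null_sets)
  have bound: "?f x \<le> ?g x" if x: "x \<notin> Z" for x
  proof (cases "x \<in> P")
    case True
    then obtain G \<xi> where G: "G \<in> T" "\<xi> \<in> ref_cell k" "x = G \<xi>"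
      using closure_subset[of P] unfolding closure_patch by blast
    have "\<xi> \<in> interior (ref_cell k)"
      using G x closed_ref_cell[of k, where 'd='d] unfolding Z_def frontier_def by (auto simp: closure_closed)
    then have "?f x \<le> ?K * ?S G"
      using norm_grad_on_tile_le[OF G(1) v zero] True G(3) by (simp only: indicator_simps scaleR_one)
    also have "\<dots> = indicator (G ` ref_cell k) x *\<^sub>R (?K * ?S G)"
      using G by simp
    also have "\<dots> \<le> ?g x"
      by (rule member_le_sum[OF G(1) g_nonneg finite_tiles])
    finally show ?thesis .
  next
    case False
    then have "?f x = 0"
      by simp
    also have "0 \<le> ?g x"
      by (intro sum_nonneg g_nonneg)
    finally show ?thesis .
  qed
  have meas: "G ` ref_cell k \<in> lmeasurable" if "G \<in> T" for G
    using that T_subset compact_cell by (intro lmeasurable_compact) auto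
  have int_g: "integrable lebesgue ?g"
    by (intro Bochner_Integration.integrable_sum integrable_indicator_scaleR meas)
  have "(LINT x|lebesgue. ?f x) \<le> (LINT x|lebesgue. ?g x)"
  \<comment> \<open>A non-integrable left-hand side has the integral 0 by convention.\<close>
  proof (cases "integrable lebesgue ?f")
    case True
    then show ?thesis
      using int_g by (rule integral_mono_AE) (rule AE_I'[OF null], use bound in blast)
  next
    case False
    have "0 \<le> (LINT x|lebesgue. ?g x)"
      by (intro integral_nonneg_AE AE_I2 sum_nonneg g_nonneg)
    then show ?thesis
      using False by (simp add: not_integrable_integral_eq)
  qed
  also have "(LINT x|lebesgue. ?g x) = (\<Sum>G\<in>T. LINT x|lebesgue. indicator (G ` ref_cell k) x *\<^sub>R (?K * ?S G))"
    by (intro Bochner_Integration.integral_sum integrable_indicator_scaleR meas)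
  also have "\<dots> = (\<Sum>G\<in>T. measure lebesgue (G ` ref_cell k) * (?K * ?S G))"
    by (intro sum.cong refl) simp
  also have "\<dots> \<le> (\<Sum>G\<in>T. (h ^ CARD('d) * ?V) * (?K * ?S G))"
  proof (intro sum_mono mult_right_mono)
    fix G assume G: "G \<in> T"
    then have GM: "G \<in> M"
      using T_subset by blast
    have "G ` ref_cell k \<noteq> {}"
    by (simp add: ref_cell_nonempty)
    then obtain x0 where x0: "x0 \<in> G ` ref_cell k"
      by blast
    have "measure lebesgue (G ` ref_cell k) \<le> measure lebesgue (cball x0 h)"
      using dist_cell_le[OF GM x0] meas[OF G] by (intro measure_mono_fmeasurable) (auto dest: fmeasurableD)
    then show "measure lebesgue (G ` ref_cell k) \<le> h ^ CARD('d) * ?V"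
      by (simp only: measure_cball_scale[OF less_imp_le[OF mesh_width_pos]] DIM_cart DIM_real mult_1_right)
  qed (intro mult_nonneg_nonneg S zero_le_power2)
  also have "\<dots> = ?V * ?K * h ^ CARD('d) * (\<Sum>G\<in>T. ?S G)"
    by (simp add: sum_distrib_left mult_ac)
  also have "(\<Sum>G\<in>T. ?S G) = (\<Sum>x\<in>nodes. \<Sum>G\<in>T. if x \<in> G ` ref_cell k then (v x)\<^sup>2 else 0)"
    by (subst sum.swap) (simp add: sum.inter_restrict[OF finite_nodes])
  also have "\<dots> = (\<Sum>x\<in>nodes. real (card {G \<in> T. x \<in> G ` ref_cell k}) * (v x)\<^sup>2)"
    by (intro sum.cong refl) (simp only: sum.inter_filter[OF finite_tiles, symmetric] sum_constant)
  also have "?V * ?K * h ^ CARD('d) * \<dots> \<le> ?V * ?K * h ^ CARD('d) * (\<Sum>x\<in>nodes. overlap_bound CARD('d) \<kappa> q * (v x)\<^sup>2)"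
  proof (intro mult_left_mono sum_mono mult_right_mono)
    fix x
    have "card {G \<in> T. x \<in> G ` ref_cell k} \<le> card {G \<in> M. x \<in> G ` ref_cell k}"
      using finite_cells T_subset by (intro card_mono) auto
    then show "real (card {G \<in> T. x \<in> G ` ref_cell k}) \<le> overlap_bound CARD('d) \<kappa> q"
      using card_cells_at_le_overlap[of x] by linarith
  qed (use mesh_width_pos in \<open>auto intro!: mult_nonneg_nonneg\<close>)
  finally show ?thesis
    unfolding L2_norm_square by (simp add: set_lebesgue_integral_def sum_distrib_left mult_ac)
qed

end


section \<open>Interpolation in the local space\<close>

lemma ref_polys_zero: "(\<lambda>_. 0) \<in> ref_polys k r"
  unfolding ref_polys_def by (intro CollectI exI[of _ "\<lambda>_. 0"]) simp

lemma ref_polys_axpy: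
  assumes "p \<in> ref_polys k r" "s \<in> ref_polys k r"
  shows "(\<lambda>x. c * p x + s x) \<in> ref_polys k r"
proof -
  obtain a where a: "p = (\<lambda>x. \<Sum>\<alpha>\<in>multi_indices k r. a \<alpha> * (\<Prod>i\<in>UNIV. (x $ i) ^ \<alpha> i))"
    using assms(1) unfolding ref_polys_def by blast
  obtain b where b: "s = (\<lambda>x. \<Sum>\<alpha>\<in>multi_indices k r. b \<alpha> * (\<Prod>i\<in>UNIV. (x $ i) ^ \<alpha> i))"
    using assms(2) unfolding ref_polys_def by blast
  have "(\<lambda>x. c * p x + s x) = (\<lambda>x. \<Sum>\<alpha>\<in>multi_indices k r. (c * a \<alpha> + b \<alpha>) * (\<Prod>i\<in>UNIV. (x $ i) ^ \<alpha> i))"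
    unfolding a b by (simp only: sum_distrib_left distrib_right sum.distrib mult.assoc)
  then show ?thesis
    unfolding ref_polys_def by (intro CollectI exI[of _ "\<lambda>\<alpha>. c * a \<alpha> + b \<alpha>"])
qed

lemma fe_space_zero: "(\<lambda>_. 0) \<in> fe_space k r D M"
  unfolding fe_space_def by (intro CollectI conjI ballI bexI[OF _ ref_polys_zero]) auto

lemma fe_space_axpy:
  assumes u: "u \<in> fe_space k r D M" and v: "v \<in> fe_space k r D M"
  shows "(\<lambda>x. c * u x + v x) \<in> fe_space k r D M"
  unfolding fe_space_def
proof (intro CollectI conjI ballI)
  show "continuous_on (closure D) (\<lambda>x. c * u x + v x)"
    using u v unfolding fe_space_def by (intro continuous_intros) blast+
  show "c * u x + v x = 0" if "x \<in> frontier D" for x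
    using u v that unfolding fe_space_def by simp
  fix F assume F: "F \<in> M"
  obtain p where p: "p \<in> ref_polys k r" "\<forall>\<xi>\<in>ref_cell k. u (F \<xi>) = p \<xi>"
    using u F unfolding fe_space_def by blast
  obtain s where s: "s \<in> ref_polys k r" "\<forall>\<xi>\<in>ref_cell k. v (F \<xi>) = s \<xi>"
    using v F unfolding fe_space_def by blast
  show "\<exists>p\<in>ref_polys k r. \<forall>\<xi>\<in>ref_cell k. c * u (F \<xi>) + v (F \<xi>) = p \<xi>"
    using ref_polys_axpy[OF p(1) s(1)] p(2) s(2) by (intro bexI[of _ "\<lambda>x. c * p x + s x"]) auto
qed

lemma local_fe_space_zero: "(\<lambda>_. 0) \<in> local_space P (fe_space k r D M)"
  unfolding local_space_def using fe_space_zero by (rule rev_image_eqI) simp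

lemma local_fe_space_axpy:
  assumes u: "u \<in> local_space P (fe_space k r D M)" and v: "v \<in> local_space P (fe_space k r D M)"
  shows "(\<lambda>x. c * u x + v x) \<in> local_space P (fe_space k r D M)"
proof -
  obtain u' where u': "u' \<in> fe_space k r D M" "u = (\<lambda>x. if x \<in> closure P then u' x else 0)"
    using u unfolding local_space_def by blast
  obtain v' where v': "v' \<in> fe_space k r D M" "v = (\<lambda>x. if x \<in> closure P then v' x else 0)"
    using v unfolding local_space_def by blast
  show ?thesis
    unfolding local_space_def using fe_space_axpy[OF u'(1) v'(1), of c]
    by (rule rev_image_eqI) (auto simp: u'(2) v'(2))
qed

lemma local_fe_space_linear_combination:
  assumes "finite I" "\<And>j. j \<in> I \<Longrightarrow> \<phi> j \<in> local_space P (fe_space k r D M)"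
  shows "(\<lambda>x. \<Sum>j\<in>I. c j * \<phi> j x) \<in> local_space P (fe_space k r D M)"
  using assms
proof (induction I)
  case empty
  then show ?case
    by (simp add: local_fe_space_zero)
next
  case (insert j I)
  have "(\<lambda>x. c j * \<phi> j x + (\<Sum>j\<in>I. c j * \<phi> j x)) \<in> local_space P (fe_space k r D M)"
    by (rule local_fe_space_axpy) (use insert in auto)
  then show ?case
    using insert.hyps by simp
qed

lemma nodal_basis_combination:
  assumes "nodal_basis V xs \<phi>" "i < length xs"
  shows "(\<Sum>j<length xs. c j * \<phi> j (xs ! i)) = c i"
proof -
  have "(\<Sum>j<length xs. c j * \<phi> j (xs ! i)) = (\<Sum>j<length xs. if j = i then c j else 0)"
    using assms by (intro sum.cong refl) (simp add: nodal_basis_def)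
  then show ?thesis
    using assms(2) by simp
qed

context patch_mesh
begin

abbreviation local_fe_space :: "(real ^ 'd \<Rightarrow> real) set" where
  "local_fe_space \<equiv> local_space P (fe_space k r D M)"

lemma fe_space_piecewise_poly: "u \<in> fe_space k r D M \<Longrightarrow> piecewise_poly u"
  unfolding fe_space_def piecewise_poly_def using T_subset by blast

lemma fe_space_continuous_on_patch: "u \<in> fe_space k r D M \<Longrightarrow> continuous_on (closure P) u"
  by (rule continuous_on_subset[OF _ closure_patch_subset]) (simp add: fe_space_def)

lemma local_fe_space_piecewise_poly:
  assumes "v \<in> local_fe_space"
  shows "piecewise_poly v"
proof -
  obtain u where u: "u \<in> fe_space k r D M" "v = (\<lambda>x. if x \<in> closure P then u x else 0)"
    using assms unfolding local_space_def by blast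
  have "v (G \<xi>) = u (G \<xi>)" if "G \<in> T" "\<xi> \<in> ref_cell k" for G \<xi>
    using tile_subset[OF that(1)] that(2) u(2) by auto
  then show ?thesis
    using fe_space_piecewise_poly[OF u(1)] unfolding piecewise_poly_def by simp
qed

lemma local_fe_space_continuous_on:
  assumes "v \<in> local_fe_space"
  shows "continuous_on (closure P) v"
proof -
  obtain u where u: "u \<in> fe_space k r D M" "v = (\<lambda>x. if x \<in> closure P then u x else 0)"
    using assms unfolding local_space_def by blast
  show ?thesis
    using fe_space_continuous_on_patch[OF u(1)] by (rule continuous_on_eq) (simp add: u(2))
qed

lemma local_fe_space_zero_on_boundary:
  assumes "v \<in> local_fe_space" "x \<in> frontier D \<inter> closure P"
  shows "v x = 0"
proof -
  obtain u where u: "u \<in> fe_space k r D M" "v = (\<lambda>x. if x \<in> closure P then u x else 0)"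
    using assms(1) unfolding local_space_def by blast
  have "u x = 0"
    using u(1) assms(2) by (simp add: fe_space_def)
  then show ?thesis
    by (simp add: u(2))
qed

lemma local_fe_space_zero_outside:
  assumes "v \<in> local_fe_space" "x \<notin> closure P"
  shows "v x = 0"
proof -
  obtain u where "v = (\<lambda>x. if x \<in> closure P then u x else 0)"
    using assms(1) unfolding local_space_def by blast
  then show ?thesis
    using assms(2) by simp
qed

text \<open>If two functions agree at the nodes, their difference vanishes at all Lagrange nodes of every tile, and
  the nodal bound holds with $m = 0$.\<close>

lemma local_fe_space_determined_by_nodes:
  assumes u: "u \<in> local_fe_space" and v: "v \<in> local_fe_space" and eq: "\<And>x. x \<in> nodes \<Longrightarrow> u x = v x"
  shows "u = v"
proof
  fix x
  define w where "w = (\<lambda>x. - 1 * v x + u x)"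
  have w: "w \<in> local_fe_space"
    unfolding w_def by (rule local_fe_space_axpy[OF v u])
  have "w x = 0"
  proof (cases "x \<in> closure P")
    case True
    then obtain G \<xi> where G: "G \<in> T" "\<xi> \<in> ref_cell k" "x = G \<xi>"
      unfolding closure_patch by blast
    obtain p where p: "p \<in> ref_polys k r" "\<And>\<xi>. \<xi> \<in> ref_cell k \<Longrightarrow> w (G \<xi>) = p \<xi>"
      using local_fe_space_piecewise_poly[OF w] G(1) unfolding piecewise_poly_def by blast
    have "(\<Sum>x\<in>nodes \<inter> G ` ref_cell k. (w x)\<^sup>2) = 0"
      by (intro sum.neutral ballI) (simp add: w_def eq)
    moreover have "\<bar>w (G \<nu>)\<bar> \<le> sqrt (\<Sum>x\<in>nodes \<inter> G ` ref_cell k. (w x)\<^sup>2)" if "\<nu> \<in> ref_nodes k r" for \<nu>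
      by (rule ref_node_value_le[OF G(1), where v = w]) (erule local_fe_space_zero_on_boundary[OF w], rule that)
    ultimately have node: "\<bar>w (G \<nu>)\<bar> \<le> 0" if "\<nu> \<in> ref_nodes k r" for \<nu>
      using that by (simp only: real_sqrt_zero)
    have "\<bar>p \<xi>\<bar> \<le> C * 0"
    proof (rule nodal_stabilityE[OF p(1)])
      show "\<bar>p \<nu>\<bar> \<le> 0" if "\<nu> \<in> ref_nodes k r" for \<nu>
        using node[OF that] by (simp only: p(2)[OF subsetD[OF ref_nodes_subset that]])
    next
      fix p' assume "\<And>\<xi>. \<xi> \<in> ref_cell k \<Longrightarrow> \<bar>p \<xi>\<bar> \<le> C * 0"
      from this[OF G(2)] show "\<bar>p \<xi>\<bar> \<le> C * 0" .
    qed
    then show ?thesis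
      using p(2)[OF G(2)] G(3) by simp
  next
    case False
    then show ?thesis
      by (rule local_fe_space_zero_outside[OF w])
  qed
  then show "u x = v x"
    by (simp add: w_def)
qed

text \<open>Existence comes from the nodal basis and uniqueness from the nodal bound, so the definite description
  is meaningful.\<close>

lemma lagrange_interpolant_in_local_space:
  assumes basis: "nodal_basis local_fe_space xs \<phi>" and xs: "set xs = nodes"
  shows "lagrange_interpolant local_fe_space (set xs) g \<in> local_fe_space \<and>
    (\<forall>x\<in>nodes. lagrange_interpolant local_fe_space (set xs) g x = g x)"
proof -
  define v where "v = (\<lambda>x. \<Sum>j<length xs. g (xs ! j) * \<phi> j x)"
  have "v \<in> local_fe_space"
    unfolding v_def using basis
    by (intro local_fe_space_linear_combination finite_lessThan) (simp add: nodal_basis_def)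
  moreover have "\<forall>x\<in>nodes. v x = g x"
    unfolding xs[symmetric] all_set_conv_all_nth v_def
    by (intro allI impI) (rule nodal_basis_combination[OF basis, where c = "\<lambda>j. g (xs ! j)"])
  ultimately have v: "v \<in> local_fe_space \<and> (\<forall>x\<in>nodes. v x = g x)"
    by (rule conjI)
  have "v' = v" if "v' \<in> local_fe_space \<and> (\<forall>x\<in>nodes. v' x = g x)" for v'
    by (rule local_fe_space_determined_by_nodes) (simp_all only: that v)
  with v have "\<exists>!v. v \<in> local_fe_space \<and> (\<forall>x\<in>nodes. v x = g x)"
    by (rule ex1I)
  then show ?thesis
    unfolding lagrange_interpolant_def xs by (rule theI')
qed

text \<open>The scale $s$ may be smaller than the mesh width: on the coarse mesh the sum is weighted with the fine
  mesh width.\<close>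

lemma scaled_nodal_sum_le_L2_norm:
  assumes e: "piecewise_poly e" "continuous_on (closure P) e" and s: "0 \<le> s" "s \<le> h"
  shows "s ^ CARD('d) * (\<Sum>x\<in>nodes. (e x)\<^sup>2) \<le> 4 * overlap_bound CARD('d) \<kappa> q * real (card (ref_nodes k r :: (real ^ 'd) set))
    / (sampling_radius CARD('d) \<kappa> q C ^ CARD('d) * measure lebesgue (ball (0 :: real ^ 'd) 1)) * (L2_norm P e)\<^sup>2"
proof -
  let ?S = "\<Sum>x\<in>nodes. (e x)\<^sup>2"
  let ?V = "measure lebesgue (ball (0 :: real ^ 'd) 1)"
  let ?m = "sampling_radius CARD('d) \<kappa> q C ^ CARD('d) * ?V"
  let ?K = "4 * overlap_bound CARD('d) \<kappa> q * real (card (ref_nodes k r :: (real ^ 'd) set)) * (L2_norm P e)\<^sup>2"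
  have m: "?m > 0"
    using sampling_radius_pos unit_ball_measure_pos by (intro mult_pos_pos zero_less_power)
  have "s ^ CARD('d) \<le> h ^ CARD('d)"
    using s by (intro power_mono)
  then have "s ^ CARD('d) * ?S * ?m \<le> h ^ CARD('d) * ?S * ?m"
    using m by (intro mult_right_mono sum_nonneg) auto
  also have "\<dots> = ?S * ((sampling_radius CARD('d) \<kappa> q C * h) ^ CARD('d) * ?V)"
    by (simp only: power_mult_distrib mult_ac)
  also have "\<dots> \<le> ?K"
    by (rule nodal_sum_le_L2_norm[OF e])
  finally have "s ^ CARD('d) * ?S \<le> ?K / ?m"
    using m by (simp only: pos_le_divide_eq)
  then show ?thesis
    by (simp only: times_divide_eq_left)
qed

lemma L2_norm_grad_le_scaled_nodal_sum:
  assumes v: "v \<in> local_fe_space"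
  shows "(L2_norm P (grad v))\<^sup>2 \<le> overlap_bound CARD('d) \<kappa> q * measure lebesgue (ball (0 :: real ^ 'd) 1) * (C * \<kappa> * q)\<^sup>2 *
    (inverse h)\<^sup>2 * (h ^ CARD('d) * (\<Sum>x\<in>nodes. (v x)\<^sup>2))"
proof -
  have "(C * \<kappa> * q / h)\<^sup>2 = (C * \<kappa> * q)\<^sup>2 * (inverse h)\<^sup>2"
    by (simp only: divide_inverse power_mult_distrib)
  moreover have "(L2_norm P (grad v))\<^sup>2 \<le> overlap_bound CARD('d) \<kappa> q * measure lebesgue (ball (0 :: real ^ 'd) 1) *
      (C * \<kappa> * q / h)\<^sup>2 * h ^ CARD('d) * (\<Sum>x\<in>nodes. (v x)\<^sup>2)"
    using local_fe_space_piecewise_poly[OF v] by (rule L2_norm_grad_le_nodal_sum) (rule local_fe_space_zero_on_boundary[OF v])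
  ultimately show ?thesis
    by (simp only: mult.assoc)
qed

end

section \<open>Networks\<close>

lemma layer_map_carrier:
  assumes "fst l \<in> carrier_mat n m" "snd l \<in> carrier_vec n" "x \<in> carrier_vec m"
  shows "layer_map l x \<in> carrier_vec n"
  unfolding layer_map_def using assms by (intro add_carrier_vec mult_mat_vec_carrier)

lemma mlp_carrier:
  assumes "network N0 NL layers" "x \<in> carrier_vec N0"
  shows "mlp \<sigma> layers x \<in> carrier_vec NL"
  using assms
proof (induction \<sigma> layers x arbitrary: N0 rule: mlp.induct)
  case (1 \<sigma> x)
  then show ?case
    by simp
next
  case (2 \<sigma> l x)
  then show ?case
    by (auto intro: layer_map_carrier)
next
  case (3 \<sigma> l l' ls x)
  then obtain N1 where N1: "fst l \<in> carrier_mat N1 N0" "snd l \<in> carrier_vec N1" "network N1 NL (l' # ls)"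
    by auto
  have "map_vec \<sigma> (layer_map l x) \<in> carrier_vec N1"
    using layer_map_carrier[OF N1(1,2) "3.prems"(2)] by simp
  then show ?case
    using "3.IH"[OF N1(3)] by simp
qed

lemma euclidean_norm_square:
  assumes "v \<in> carrier_vec n"
  shows "(euclidean_norm v)\<^sup>2 = (\<Sum>i<n. (vec_index v i)\<^sup>2)"
proof -
  have "scalar_prod v v = (\<Sum>i<n. (vec_index v i)\<^sup>2)"
    using assms by (simp add: scalar_prod_def lessThan_atLeast0 power2_eq_square)
  then show ?thesis
    unfolding euclidean_norm_def by (simp only: real_sqrt_pow2 sum_nonneg zero_le_power2)
qed

lemma network_input_carrier: "network_input xsH xsh u f \<in> carrier_vec (length xsH + length xsh)"
  unfolding network_input_def by (rule carrier_vecI) (simp only: dim_vec_of_list length_append length_map)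

lemma euclidean_norm_nonneg: "euclidean_norm v \<ge> 0"
  unfolding euclidean_norm_def scalar_prod_def by (intro real_sqrt_ge_zero sum_nonneg zero_le_square)

lemma euclidean_norm_square_input_difference:
  assumes "distinct xsH" "distinct xsh"
  shows "(euclidean_norm (network_input xsH xsh u f - network_input xsH xsh u' f'))\<^sup>2 =
    (\<Sum>x\<in>set xsH. (u x - u' x)\<^sup>2) + (\<Sum>x\<in>set xsh. (f x - f' x)\<^sup>2)"
proof -
  let ?n = "length xsH + length xsh"
  let ?zs = "map (\<lambda>x. (u x - u' x)\<^sup>2) xsH @ map (\<lambda>x. (f x - f' x)\<^sup>2) xsh"
  note carrier = network_input_carrier[of xsH xsh]
  have index: "vec_index (network_input xsH xsh v g) i = (map v xsH @ map g xsh) ! i" for v g i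
    by (simp add: network_input_def vec_of_list_index)
  have "(euclidean_norm (network_input xsH xsh u f - network_input xsH xsh u' f'))\<^sup>2 =
      (\<Sum>i<?n. (vec_index (network_input xsH xsh u f - network_input xsH xsh u' f') i)\<^sup>2)"
    by (rule euclidean_norm_square[OF minus_carrier_vec[OF carrier carrier]])
  also have "\<dots> = (\<Sum>i<?n. ?zs ! i)"
  proof (rule sum.cong)
    fix i assume i: "i \<in> {..<?n}"
    then have "vec_index (network_input xsH xsh u f - network_input xsH xsh u' f') i =
        vec_index (network_input xsH xsh u f) i - vec_index (network_input xsH xsh u' f') i"
      using carrier[of u' f'] by (intro index_minus_vec(1)) auto
    then show "(vec_index (network_input xsH xsh u f - network_input xsH xsh u' f') i)\<^sup>2 = ?zs ! i"
      using i by (auto simp: index nth_append)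
  qed simp
  also have "\<dots> = sum_list ?zs"
    by (simp add: sum_list_sum_nth lessThan_atLeast0)
  also have "\<dots> = (\<Sum>x\<in>set xsH. (u x - u' x)\<^sup>2) + (\<Sum>x\<in>set xsh. (f x - f' x)\<^sup>2)"
    using assms by (simp add: sum_list_distinct_conv_sum_set)
  finally show ?thesis .
qed


section \<open>Stability of the network update\<close>

definition inverse_estimate_const :: "nat \<Rightarrow> real \<Rightarrow> real \<Rightarrow> real \<Rightarrow> real \<Rightarrow> real" where
  "inverse_estimate_const d vol \<kappa> q C = overlap_bound d \<kappa> q * vol * (C * \<kappa> * q)\<^sup>2"

definition sampling_const :: "nat \<Rightarrow> real \<Rightarrow> nat \<Rightarrow> real \<Rightarrow> real \<Rightarrow> real \<Rightarrow> real" where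
  "sampling_const d vol N \<kappa> q C = 4 * overlap_bound d \<kappa> q * real N / (sampling_radius d \<kappa> q C ^ d * vol)"

lemma network_update_difference:
  assumes "y \<in> carrier_vec N" "y' \<in> carrier_vec N"
  shows "network_update \<phi> y x - network_update \<phi> y' x = (\<Sum>j<N. (vec_index y j - vec_index y' j) * \<phi> j x)"
  using assms by (simp add: network_update_def sum_subtractf left_diff_distrib)

text \<open>The difference of the updates has the differences of the network outputs as its nodal values.\<close>

lemma (in patch_mesh) L2_norm_grad_network_update_difference_le:
  assumes basis: "nodal_basis local_fe_space xs \<phi>" and xs: "distinct xs" "set xs = nodes"
    and y: "y \<in> carrier_vec (length xs)" "y' \<in> carrier_vec (length xs)"
  shows "(L2_norm P (grad (\<lambda>x. network_update \<phi> y x - network_update \<phi> y' x)))\<^sup>2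
    \<le> inverse_estimate_const CARD('d) (measure lebesgue (ball (0 :: real ^ 'd) 1)) \<kappa> q C *
      (inverse h)\<^sup>2 * (h ^ CARD('d) * (euclidean_norm (y - y'))\<^sup>2)"
proof -
  let ?N = "length xs"
  define v where "v = (\<lambda>x. \<Sum>j<?N. (vec_index y j - vec_index y' j) * \<phi> j x)"
  have v: "v \<in> local_fe_space"
    unfolding v_def using basis
    by (intro local_fe_space_linear_combination finite_lessThan) (simp add: nodal_basis_def)
  have nodal: "v (xs ! i) = vec_index y i - vec_index y' i" if i: "i < ?N" for i
    unfolding v_def by (rule nodal_basis_combination[OF basis i])
  have "(\<Sum>x\<in>nodes. (v x)\<^sup>2) = (\<Sum>i<?N. (v (xs ! i))\<^sup>2)"
    using sum.reindex_bij_betw[OF bij_betw_nth[OF xs(1) refl xs(2)[symmetric]], of "\<lambda>x. (v x)\<^sup>2"] by simp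
  also have "\<dots> = (\<Sum>i<?N. (vec_index (y - y') i)\<^sup>2)"
    using y by (intro sum.cong refl) (simp add: nodal)
  also have "\<dots> = (euclidean_norm (y - y'))\<^sup>2"
    using euclidean_norm_square[OF minus_carrier_vec[OF y]] by simp
  finally have sum: "(\<Sum>x\<in>nodes. (v x)\<^sup>2) = (euclidean_norm (y - y'))\<^sup>2" .
  have "(\<lambda>x. network_update \<phi> y x - network_update \<phi> y' x) = v"
    unfolding v_def by (rule ext) (rule network_update_difference[OF y])
  then show ?thesis
    using L2_norm_grad_le_scaled_nodal_sum[OF v] by (simp only: sum inverse_estimate_const_def)
qed

text \<open>The factor $h^d$ of the inverse estimate is passed through the Lipschitz bound to the sums over
  the coarse and the fine nodes of the two inputs, where it turns them into $L^2$ norms; on the coarse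
  mesh this uses $h \<le> H$.\<close>

lemma network_update_stability:
  fixes D :: "(real ^ 'd) set" and M :: "nat \<Rightarrow> 'd mesh"
  assumes degree: "r \<ge> 1" and open_D: "open D" and D: "D \<noteq> {}"
    and C: "C \<ge> 1" "\<And>p :: real ^ 'd \<Rightarrow> real. p \<in> ref_polys k r \<Longrightarrow> nodally_bounded k r C p"
    and hier: "mesh_hierarchy k D \<kappa> n M" and l: "l \<le> n"
    and uniform: "quasi_uniform k q (M l)" "quasi_uniform k q (M n)"
    and patch: "is_patch k a (M 0) P"
    and u: "u \<in> fe_space k r D (M l)" "u' \<in> fe_space k r D (M l)"
    and xsH: "distinct xsH" "set xsH = patch_nodes k r D (M l) P"
    and xsh: "distinct xsh" "set xsh = patch_nodes k r D (M n) P"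
    and basis: "nodal_basis (local_space P (fe_space k r D (M n))) xsh \<phi>"
    and net: "network (length xsH + length xsh) (length xsh) layers"
    and lipschitz: "lipschitz_network (length xsH + length xsh) L (mlp \<sigma> layers)"
  defines "N \<equiv> mlp \<sigma> layers"
    and "K \<equiv> inverse_estimate_const CARD('d) (measure lebesgue (ball (0 :: real ^ 'd) 1)) \<kappa> q C *
      sampling_const CARD('d) (measure lebesgue (ball (0 :: real ^ 'd) 1)) (card (ref_nodes k r :: (real ^ 'd) set)) \<kappa> q C"
  shows "L2_norm P (grad (\<lambda>x. network_update \<phi> (N (network_input xsH xsh u f)) x
        - network_update \<phi> (N (network_input xsH xsh u' f')) x))
    \<le> sqrt K * L * inverse (mesh_width k (M n)) * (L2_norm P (\<lambda>x. u x - u' x) +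
        L2_norm P (lagrange_interpolant (local_space P (fe_space k r D (M n))) (set xsh) (\<lambda>x. f x - f' x)))"
proof -
  obtain Th where Th: "Th \<subseteq> M n" "tiles k Th P"
    using patch_tiled_by_finer_cells[OF hier order_refl D patch] by blast
  obtain TH where TH: "TH \<subseteq> M l" "tiles k TH P"
    using patch_tiled_by_finer_cells[OF hier l D patch] by blast
  have mesh: "conforming_mesh k D (M j)" "shape_regular k \<kappa> (M j)" if "j \<le> n" for j
    using hier that unfolding mesh_hierarchy_def by auto
  interpret fine: patch_mesh k D "M n" \<kappa> q r C P Th
    by unfold_locales (fact mesh[OF order_refl] D uniform degree open_D C Th)+
  interpret coarse: patch_mesh k D "M l" \<kappa> q r C P TH
    by unfold_locales (fact mesh[OF l] D uniform degree open_D C TH)+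
  let ?h = "mesh_width k (M n)"
  let ?vol = "measure lebesgue (ball (0 :: real ^ 'd) 1)"
  let ?K1 = "inverse_estimate_const CARD('d) ?vol \<kappa> q C"
  let ?K2 = "sampling_const CARD('d) ?vol (card (ref_nodes k r :: (real ^ 'd) set)) \<kappa> q C"
  define e where "e = (\<lambda>x. u x - u' x)"
  define g where "g = lagrange_interpolant (local_space P (fe_space k r D (M n))) (set xsh) (\<lambda>x. f x - f' x)"
  define x where "x = network_input xsH xsh u f"
  define x' where "x' = network_input xsH xsh u' f'"
  have h: "0 \<le> ?h" "?h \<le> mesh_width k (M l)"
    using fine.mesh_width_pos mesh_hierarchy_width_antimono[OF hier l D] by simp_all
  have K1: "?K1 \<ge> 0"
    unfolding inverse_estimate_const_def using fine.overlap_nonneg by simp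
  have K2: "?K2 \<ge> 0"
    unfolding sampling_const_def using fine.overlap_nonneg fine.sampling_radius_pos by simp
  have "(\<lambda>x. - 1 * u' x + u x) \<in> fe_space k r D (M l)"
    using u by (intro fe_space_axpy)
  then have e: "e \<in> fe_space k r D (M l)"
    by (simp add: e_def)
  have e_bound: "?h ^ CARD('d) * (\<Sum>x\<in>set xsH. (e x)\<^sup>2) \<le> ?K2 * (L2_norm P e)\<^sup>2"
    unfolding xsH(2) sampling_const_def
    by (rule coarse.scaled_nodal_sum_le_L2_norm[OF coarse.fe_space_piecewise_poly[OF e]
        coarse.fe_space_continuous_on_patch[OF e] h])
  have g: "g \<in> local_space P (fe_space k r D (M n))" "\<And>x. x \<in> set xsh \<Longrightarrow> g x = f x - f' x"
    using fine.lagrange_interpolant_in_local_space[OF basis xsh(2), of "\<lambda>x. f x - f' x"]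
    unfolding g_def xsh(2) by blast+
  have "?h ^ CARD('d) * (\<Sum>x\<in>set xsh. (g x)\<^sup>2) \<le> ?K2 * (L2_norm P g)\<^sup>2"
    unfolding xsh(2) sampling_const_def
    by (rule fine.scaled_nodal_sum_le_L2_norm[OF fine.local_fe_space_piecewise_poly[OF g(1)]
        fine.local_fe_space_continuous_on[OF g(1)] h(1) order_refl])
  then have g_bound: "?h ^ CARD('d) * (\<Sum>x\<in>set xsh. (f x - f' x)\<^sup>2) \<le> ?K2 * (L2_norm P g)\<^sup>2"
    by (simp only: g(2) cong: sum.cong)
  have carrier: "x \<in> carrier_vec (length xsH + length xsh)" "x' \<in> carrier_vec (length xsH + length xsh)"
    unfolding x_def x'_def by (rule network_input_carrier)+
  have L: "L \<ge> 0" and "euclidean_norm (N x - N x') \<le> L * euclidean_norm (x - x')"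
    using lipschitz carrier unfolding lipschitz_network_def N_def by simp_all
  then have "(euclidean_norm (N x - N x'))\<^sup>2 \<le> (L * euclidean_norm (x - x'))\<^sup>2"
    by (intro power_mono euclidean_norm_nonneg)
  also have "\<dots> = L\<^sup>2 * ((\<Sum>x\<in>set xsH. (e x)\<^sup>2) + (\<Sum>x\<in>set xsh. (f x - f' x)\<^sup>2))"
    unfolding x_def x'_def e_def power_mult_distrib
      euclidean_norm_square_input_difference[OF xsH(1) xsh(1)] ..
  finally have "?h ^ CARD('d) * (euclidean_norm (N x - N x'))\<^sup>2
      \<le> ?h ^ CARD('d) * (L\<^sup>2 * ((\<Sum>x\<in>set xsH. (e x)\<^sup>2) + (\<Sum>x\<in>set xsh. (f x - f' x)\<^sup>2)))"
    using h by (intro mult_left_mono) auto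
  also have "\<dots> = L\<^sup>2 * (?h ^ CARD('d) * (\<Sum>x\<in>set xsH. (e x)\<^sup>2) + ?h ^ CARD('d) * (\<Sum>x\<in>set xsh. (f x - f' x)\<^sup>2))"
    by (simp only: algebra_simps)
  also have "\<dots> \<le> L\<^sup>2 * (?K2 * (L2_norm P e)\<^sup>2 + ?K2 * (L2_norm P g)\<^sup>2)"
    by (intro mult_left_mono add_mono e_bound g_bound zero_le_power2)
  also have "\<dots> = L\<^sup>2 * ?K2 * ((L2_norm P e)\<^sup>2 + (L2_norm P g)\<^sup>2)"
    by (simp only: algebra_simps)
  also have "\<dots> \<le> L\<^sup>2 * ?K2 * (L2_norm P e + L2_norm P g)\<^sup>2"
    using K2 L2_norm_nonneg[of P e] L2_norm_nonneg[of P g]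
    by (intro mult_left_mono) (auto simp: power2_sum)
  finally have output_bound: "?h ^ CARD('d) * (euclidean_norm (N x - N x'))\<^sup>2
      \<le> L\<^sup>2 * ?K2 * (L2_norm P e + L2_norm P g)\<^sup>2" .
  have "N x \<in> carrier_vec (length xsh)" "N x' \<in> carrier_vec (length xsh)"
    unfolding N_def by (rule mlp_carrier[OF net carrier(1)], rule mlp_carrier[OF net carrier(2)])
  from fine.L2_norm_grad_network_update_difference_le[OF basis xsh this]
  have "(L2_norm P (grad (\<lambda>z. network_update \<phi> (N x) z - network_update \<phi> (N x') z)))\<^sup>2
      \<le> ?K1 * (inverse ?h)\<^sup>2 * (?h ^ CARD('d) * (euclidean_norm (N x - N x'))\<^sup>2)" .
  also have "\<dots> \<le> ?K1 * (inverse ?h)\<^sup>2 * (L\<^sup>2 * ?K2 * (L2_norm P e + L2_norm P g)\<^sup>2)"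
    using K1 by (intro mult_left_mono output_bound) simp
  also have "\<dots> = (sqrt K * L * inverse ?h * (L2_norm P e + L2_norm P g))\<^sup>2"
  proof -
    have "(sqrt K)\<^sup>2 = ?K1 * ?K2"
      unfolding K_def using K1 K2 by (intro real_sqrt_pow2 mult_nonneg_nonneg)
    then show ?thesis
      by (simp only: power_mult_distrib mult_ac)
  qed
  finally have "L2_norm P (grad (\<lambda>z. network_update \<phi> (N x) z - network_update \<phi> (N x') z))
      \<le> sqrt K * L * inverse ?h * (L2_norm P e + L2_norm P g)"
  proof (rule power2_le_imp_le)
    show "0 \<le> sqrt K * L * inverse ?h * (L2_norm P e + L2_norm P g)"
      using K1 K2 L h L2_norm_nonneg[of P e] L2_norm_nonneg[of P g] unfolding K_def by simp
  qed
  then show ?thesis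
    unfolding x_def x'_def e_def g_def .
qed

theorem lemma1:
  fixes D :: "(real ^ 'd) set" and k :: cell_kind and r :: nat and \<kappa> q a :: real
  assumes dim: "CARD('d) = 2 \<or> CARD('d) = 3"
    and domain: "polygonal_domain D"
    and degree: "r \<ge> 1"
  shows "\<exists>c>0. \<forall>(M :: nat \<Rightarrow> 'd mesh) l n P f fi uH uHi xsH xsh \<phi> \<sigma> layers L.
    mesh_hierarchy k D \<kappa> n M \<longrightarrow> l \<le> n \<longrightarrow>
    quasi_uniform k q (M l) \<longrightarrow> quasi_uniform k q (M n) \<longrightarrow>
    is_patch k a (M 0) P \<longrightarrow>
    continuous_on (closure D) f \<longrightarrow> continuous_on (closure D) fi \<longrightarrow>
    galerkin_solution D (fe_space k r D (M l)) f uH \<longrightarrow>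
    galerkin_solution D (fe_space k r D (M l)) fi uHi \<longrightarrow>
    distinct xsH \<longrightarrow> set xsH = patch_nodes k r D (M l) P \<longrightarrow>
    distinct xsh \<longrightarrow> set xsh = patch_nodes k r D (M n) P \<longrightarrow>
    nodal_basis (local_space P (fe_space k r D (M n))) xsh \<phi> \<longrightarrow>
    network (length xsH + length xsh) (length xsh) layers \<longrightarrow>
    lipschitz_network (length xsH + length xsh) L (mlp \<sigma> layers) \<longrightarrow>
    (let V = local_space P (fe_space k r D (M n));
         h = mesh_width k (M n);
         w = network_update \<phi> (mlp \<sigma> layers (network_input xsH xsh uH f));
         wi = network_update \<phi> (mlp \<sigma> layers (network_input xsH xsh uHi fi))
     in L2_norm P (grad (\<lambda>x. w x - wi x))
        \<le> c * L * inverse h *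
           (L2_norm P (\<lambda>x. uH x - uHi x) +
            L2_norm P (lagrange_interpolant V (set xsh) (\<lambda>x. f x - fi x))))"
proof -
  obtain C where C: "C \<ge> 1" "\<And>p :: real ^ 'd \<Rightarrow> real. p \<in> ref_polys k r \<Longrightarrow> nodally_bounded k r C p"
    using ref_poly_bounded_by_nodal_values[OF degree, where 'd='d and k=k] by blast
  let ?vol = "measure lebesgue (ball (0 :: real ^ 'd) 1)"
  define K where "K = inverse_estimate_const CARD('d) ?vol \<kappa> q C *
      sampling_const CARD('d) ?vol (card (ref_nodes k r :: (real ^ 'd) set)) \<kappa> q C"
  have D: "open D" "D \<noteq> {}"
    using domain unfolding polygonal_domain_def by blast+
  show ?thesis
  proof (intro exI[of _ "\<bar>sqrt K\<bar> + 1"] conjI allI impI, goal_cases)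
    case 1
    show ?case
      by linarith
  next
    case (2 M l n P f fi uH uHi xsH xsh \<phi> \<sigma> layers L)
    let ?h = "mesh_width k (M n)"
    let ?R = "L2_norm P (\<lambda>x. uH x - uHi x) + L2_norm P
        (lagrange_interpolant (local_space P (fe_space k r D (M n))) (set xsh) (\<lambda>x. f x - fi x))"
    have u: "uH \<in> fe_space k r D (M l)" "uHi \<in> fe_space k r D (M l)"
      using 2(8,9) unfolding galerkin_solution_def by blast+
    have "L2_norm P (grad (\<lambda>x. network_update \<phi> (mlp \<sigma> layers (network_input xsH xsh uH f)) x
        - network_update \<phi> (mlp \<sigma> layers (network_input xsH xsh uHi fi)) x))
      \<le> sqrt K * L * inverse ?h * ?R"
      unfolding K_def
      by (rule network_update_stability[OF degree D C 2(1-5) u 2(10-16)])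
    also have "\<dots> \<le> (\<bar>sqrt K\<bar> + 1) * L * inverse ?h * ?R"
    proof (intro mult_right_mono)
      interpret conforming k D "M n"
        using mesh_hierarchy_conforming[OF 2(1) order_refl D(2)] .
      show "0 \<le> inverse ?h"
        using mesh_width_pos by simp
      show "0 \<le> L"
        using 2(16) by (simp add: lipschitz_network_def)
      show "0 \<le> ?R"
        by (intro add_nonneg_nonneg L2_norm_nonneg)
    qed linarith
    finally show ?case
      by (simp only: Let_def)
  qed
qed

end
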